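(* Let $R$ be a ring and let $f(x)\in R[x]$ be a monic polynomial of degree $n$. If $f(x)$ is irreducible in $R[x]$, then every subgroup $G\subseteq\mathrm{S}_n$ for which $R[x]/(f(x))$ has a $G$-closure datum over $R$ acts transitively on $\{1,\dots,n\}$.
   Context: All rings and algebras are commutative with 1. For an $R$-algebra $A$ that is locally free of rank $n$ as an $R$-module: $A^{\otimes n}$ is the $n$-fold tensor power over $R$; for $a\in A$, $a^{(i)}\in A^{\otimes n}$ is the pure tensor with $a$ in position $i$ and $1$ elsewhere. $\mathrm{S}_n$ acts on $A^{\otimes n}$ by the $R$-algebra automorphisms with $\sigma\cdot a^{(i)}=a^{(\sigma(i))}$; $(A^{\otimes n})^G$ is the subalgebra of $G$-invariants. $e_k(a)\in (A^{\otimes n})^{\mathrm{S}_n}$ is the $k$-th elementary symmetric polynomial in $a^{(1)},\dots,a^{(n)}$, and $s_k(a)\in R$ is defined by the characteristic polynomial of multiplication by $a$ on $A$: $\lambda^n-s_1(a)\lambda^{n-1}+\dots+(-1)^ns_n(a)$. A $G$-closure datum for $A$ over $R$ is an $R$-algebra homomorphism $\varphi:(A^{\otimes n})^{G}\to R$ with $\varphi(e_k(a))=s_k(a)$ for all $a\in A$, $1\le k\le n$. *)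

theory Defs
  imports
    "HOL-Algebra.UnivPoly"
    "HOL-Algebra.QuotRing"
    "HOL-Algebra.Ring_Divisibility"
    "HOL-Algebra.Product_Groups"
    "HOL-Algebra.Sym_Groups"
begin

section \<open>Quotient algebras\<close>

definition quotient_algebra ::
  "('r, 'm) ring_scheme \<Rightarrow> ('r, 'a, 'c) module_scheme \<Rightarrow> 'a set \<Rightarrow> ('r, 'a set) module"
  where "quotient_algebra R A I =
    \<lparr>carrier = carrier (A Quot I),
     monoid.mult = monoid.mult (A Quot I),
     one = one (A Quot I),
     zero = zero (A Quot I),
     add = add (A Quot I),
     smult = (\<lambda>r X. \<Union>x\<in>X. I +>\<^bsub>A\<^esub> (r \<odot>\<^bsub>A\<^esub> x))\<rparr>"


section \<open>Characteristic polynomial of an element of a free algebra\<close>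

text \<open>The determinant in the library is tied to type classes, hence the Leibniz formula.\<close>

definition ring_det :: "('r, 'm) ring_scheme \<Rightarrow> nat \<Rightarrow> (nat \<Rightarrow> nat \<Rightarrow> 'r) \<Rightarrow> 'r"
  where "ring_det R n M =
    (\<Oplus>\<^bsub>R\<^esub>p\<in>{p. p permutes {..<n}}.
       (if evenperm p then \<one>\<^bsub>R\<^esub> else \<ominus>\<^bsub>R\<^esub> \<one>\<^bsub>R\<^esub>) \<otimes>\<^bsub>R\<^esub> (\<Otimes>\<^bsub>R\<^esub>i\<in>{..<n}. M i (p i)))"

definition module_basis ::
  "('r, 'm) ring_scheme \<Rightarrow> ('r, 'a, 'c) module_scheme \<Rightarrow> nat \<Rightarrow> (nat \<Rightarrow> 'a) \<Rightarrow> bool"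
  where "module_basis R A n b \<longleftrightarrow>
    b \<in> {..<n} \<rightarrow> carrier A \<and>
    (\<forall>x\<in>carrier A. \<exists>!c. c \<in> {..<n} \<rightarrow>\<^sub>E carrier R \<and> x = (\<Oplus>\<^bsub>A\<^esub>i\<in>{..<n}. c i \<odot>\<^bsub>A\<^esub> b i))"

definition coords ::
  "('r, 'm) ring_scheme \<Rightarrow> ('r, 'a, 'c) module_scheme \<Rightarrow> nat \<Rightarrow> (nat \<Rightarrow> 'a) \<Rightarrow> 'a \<Rightarrow> nat \<Rightarrow> 'r"
  where "coords R A n b x =
    (THE c. c \<in> {..<n} \<rightarrow>\<^sub>E carrier R \<and> x = (\<Oplus>\<^bsub>A\<^esub>i\<in>{..<n}. c i \<odot>\<^bsub>A\<^esub> b i))"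

definition mult_matrix ::
  "('r, 'm) ring_scheme \<Rightarrow> ('r, 'a, 'c) module_scheme \<Rightarrow> nat \<Rightarrow> (nat \<Rightarrow> 'a) \<Rightarrow> 'a
    \<Rightarrow> nat \<Rightarrow> nat \<Rightarrow> 'r"
  where "mult_matrix R A n b a i j = coords R A n b (a \<otimes>\<^bsub>A\<^esub> b j) i"

definition mult_char_poly ::
  "('r, 'm) ring_scheme \<Rightarrow> ('r, 'a, 'c) module_scheme \<Rightarrow> nat \<Rightarrow> (nat \<Rightarrow> 'a) \<Rightarrow> 'a \<Rightarrow> nat \<Rightarrow> 'r"
  where "mult_char_poly R A n b a =
    ring_det (UP R) n
      (\<lambda>i j. (if i = j then monom (UP R) \<one>\<^bsub>R\<^esub> 1 else \<zero>\<^bsub>UP R\<^esub>)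
             \<ominus>\<^bsub>UP R\<^esub> monom (UP R) (mult_matrix R A n b a i j) 0)"

text \<open>The characteristic polynomial is
  \<open>\<lambda>^n - s_1(a) \<lambda>^(n-1) + \<dots> + (-1)^n s_n(a)\<close>.\<close>

definition char_coeff ::
  "('r, 'm) ring_scheme \<Rightarrow> ('r, 'a, 'c) module_scheme \<Rightarrow> nat \<Rightarrow> (nat \<Rightarrow> 'a) \<Rightarrow> 'a \<Rightarrow> nat \<Rightarrow> 'r"
  where "char_coeff R A n b a k =
    (\<ominus>\<^bsub>R\<^esub> \<one>\<^bsub>R\<^esub>) [^]\<^bsub>R\<^esub> k \<otimes>\<^bsub>R\<^esub> coeff (UP R) (mult_char_poly R A n b a) (n - k)"


section \<open>Monoid algebras\<close>

definition monoid_algebra ::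
  "('r, 'm) ring_scheme \<Rightarrow> ('b, 'd) monoid_scheme \<Rightarrow> ('r, 'b \<Rightarrow> 'r) module"
  where "monoid_algebra R M =
    \<lparr>carrier = {u. (\<forall>x. u x \<in> carrier R) \<and> finite {x. u x \<noteq> \<zero>\<^bsub>R\<^esub>} \<and>
                   {x. u x \<noteq> \<zero>\<^bsub>R\<^esub>} \<subseteq> carrier M},
     monoid.mult = (\<lambda>u v x. \<Oplus>\<^bsub>R\<^esub>y\<in>{y. u y \<noteq> \<zero>\<^bsub>R\<^esub>}. \<Oplus>\<^bsub>R\<^esub>z\<in>{z. v z \<noteq> \<zero>\<^bsub>R\<^esub>}.
                             if y \<otimes>\<^bsub>M\<^esub> z = x then u y \<otimes>\<^bsub>R\<^esub> v z else \<zero>\<^bsub>R\<^esub>),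
     one = (\<lambda>x. if x = \<one>\<^bsub>M\<^esub> then \<one>\<^bsub>R\<^esub> else \<zero>\<^bsub>R\<^esub>),
     zero = (\<lambda>x. \<zero>\<^bsub>R\<^esub>),
     add = (\<lambda>u v x. u x \<oplus>\<^bsub>R\<^esub> v x),
     smult = (\<lambda>r u x. r \<otimes>\<^bsub>R\<^esub> u x)\<rparr>"

definition single :: "('r, 'm) ring_scheme \<Rightarrow> 'b \<Rightarrow> 'b \<Rightarrow> 'r"
  where "single R x = (\<lambda>y. if y = x then \<one>\<^bsub>R\<^esub> else \<zero>\<^bsub>R\<^esub>)"


section \<open>Tensor powers of an algebra\<close>

text \<open>The free \<open>R\<close>-module on \<open>A^n\<close>, with basis elements multiplied componentwise. The submodule
  spanned by the multilinearity relators is stable under multiplication by basis elements, so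
  it is the ideal they generate; the quotient is the usual tensor power, with the
  multiplication \<open>(a_1 \<otimes> \<dots> \<otimes> a_n) (b_1 \<otimes> \<dots> \<otimes> b_n) = a_1 b_1 \<otimes> \<dots> \<otimes> a_n b_n\<close>.\<close>

definition free_tensor ::
  "('r, 'm) ring_scheme \<Rightarrow> ('r, 'a, 'c) module_scheme \<Rightarrow> nat \<Rightarrow> ('r, (nat \<Rightarrow> 'a) \<Rightarrow> 'r) module"
  where "free_tensor R A n = monoid_algebra R (product_group {1..n} (\<lambda>_. A))"

definition multilinear_relators ::
  "('r, 'm) ring_scheme \<Rightarrow> ('r, 'a, 'c) module_scheme \<Rightarrow> nat \<Rightarrow> ((nat \<Rightarrow> 'a) \<Rightarrow> 'r) set"
  where "multilinear_relators R A n =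
    {single R (a(i := x \<oplus>\<^bsub>A\<^esub> y)) \<ominus>\<^bsub>free_tensor R A n\<^esub>
       (single R (a(i := x)) \<oplus>\<^bsub>free_tensor R A n\<^esub> single R (a(i := y))) | a i x y.
       a \<in> {1..n} \<rightarrow>\<^sub>E carrier A \<and> i \<in> {1..n} \<and> x \<in> carrier A \<and> y \<in> carrier A} \<union>
    {single R (a(i := r \<odot>\<^bsub>A\<^esub> x)) \<ominus>\<^bsub>free_tensor R A n\<^esub>
       (r \<odot>\<^bsub>free_tensor R A n\<^esub> single R (a(i := x))) | a i r x.
       a \<in> {1..n} \<rightarrow>\<^sub>E carrier A \<and> i \<in> {1..n} \<and> r \<in> carrier R \<and> x \<in> carrier A}"

definition tensor_ideal ::
  "('r, 'm) ring_scheme \<Rightarrow> ('r, 'a, 'c) module_scheme \<Rightarrow> nat \<Rightarrow> ((nat \<Rightarrow> 'a) \<Rightarrow> 'r) set"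
  where "tensor_ideal R A n = Idl\<^bsub>free_tensor R A n\<^esub> (multilinear_relators R A n)"

definition tensor_power ::
  "('r, 'm) ring_scheme \<Rightarrow> ('r, 'a, 'c) module_scheme \<Rightarrow> nat
    \<Rightarrow> ('r, ((nat \<Rightarrow> 'a) \<Rightarrow> 'r) set) module"
  where "tensor_power R A n = quotient_algebra R (free_tensor R A n) (tensor_ideal R A n)"

definition pure_tensor ::
  "('r, 'm) ring_scheme \<Rightarrow> ('r, 'a, 'c) module_scheme \<Rightarrow> nat \<Rightarrow> (nat \<Rightarrow> 'a)
    \<Rightarrow> ((nat \<Rightarrow> 'a) \<Rightarrow> 'r) set"
  where "pure_tensor R A n a = tensor_ideal R A n +>\<^bsub>free_tensor R A n\<^esub> single R a"

definition tensor_embed ::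
  "('r, 'm) ring_scheme \<Rightarrow> ('r, 'a, 'c) module_scheme \<Rightarrow> nat \<Rightarrow> nat \<Rightarrow> 'a
    \<Rightarrow> ((nat \<Rightarrow> 'a) \<Rightarrow> 'r) set"
  where "tensor_embed R A n i a = pure_tensor R A n (\<lambda>j\<in>{1..n}. if j = i then a else \<one>\<^bsub>A\<^esub>)"

text \<open>On the free module, \<open>u \<mapsto> (\<lambda>a. u (a \<circ> \<sigma>))\<close> sends the basis element of \<open>a\<close> to that of
  \<open>a \<circ> \<sigma>\<^sup>-\<^sup>1\<close>, i.e. moves the entry in position \<open>i\<close> to position \<open>\<sigma> i\<close>. The ideal is
  stable under this map, so taking images of cosets is the induced map on the quotient.\<close>

definition tensor_perm :: "(nat \<Rightarrow> nat) \<Rightarrow> ((nat \<Rightarrow> 'a) \<Rightarrow> 'r) set \<Rightarrow> ((nat \<Rightarrow> 'a) \<Rightarrow> 'r) set"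
  where "tensor_perm \<sigma> X = (\<lambda>u a. u (a \<circ> \<sigma>)) ` X"

definition tensor_invariants ::
  "('r, 'm) ring_scheme \<Rightarrow> ('r, 'a, 'c) module_scheme \<Rightarrow> nat \<Rightarrow> (nat \<Rightarrow> nat) set
    \<Rightarrow> ('r, ((nat \<Rightarrow> 'a) \<Rightarrow> 'r) set) module"
  where "tensor_invariants R A n G = (tensor_power R A n)
    \<lparr>carrier := {t \<in> carrier (tensor_power R A n). \<forall>\<sigma>\<in>G. tensor_perm \<sigma> t = t}\<rparr>"

definition tensor_elem_sym ::
  "('r, 'm) ring_scheme \<Rightarrow> ('r, 'a, 'c) module_scheme \<Rightarrow> nat \<Rightarrow> nat \<Rightarrow> 'a
    \<Rightarrow> ((nat \<Rightarrow> 'a) \<Rightarrow> 'r) set"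
  where "tensor_elem_sym R A n k a =
    (\<Oplus>\<^bsub>tensor_power R A n\<^esub>K\<in>{K. K \<subseteq> {1..n} \<and> card K = k}.
       \<Otimes>\<^bsub>tensor_power R A n\<^esub>i\<in>K. tensor_embed R A n i a)"


section \<open>\<open>G\<close>-closure data\<close>

text \<open>Stated for algebras that are free of rank \<open>n\<close>. The elements \<open>s_k(a)\<close> do not depend on
  the basis used to compute them.\<close>

definition G_closure_datum ::
  "('r, 'm) ring_scheme \<Rightarrow> ('r, 'a, 'c) module_scheme \<Rightarrow> nat \<Rightarrow> (nat \<Rightarrow> nat) set
    \<Rightarrow> (((nat \<Rightarrow> 'a) \<Rightarrow> 'r) set \<Rightarrow> 'r) \<Rightarrow> bool"
  where "G_closure_datum R A n G \<phi> \<longleftrightarrow>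
    (\<exists>b. module_basis R A n b) \<and>
    \<phi> \<in> ring_hom (tensor_invariants R A n G) R \<and>
    (\<forall>r\<in>carrier R. \<forall>t\<in>carrier (tensor_invariants R A n G).
       \<phi> (r \<odot>\<^bsub>tensor_invariants R A n G\<^esub> t) = r \<otimes>\<^bsub>R\<^esub> \<phi> t) \<and>
    (\<forall>b. module_basis R A n b \<longrightarrow>
       (\<forall>a\<in>carrier A. \<forall>k\<in>{1..n}. \<phi> (tensor_elem_sym R A n k a) = char_coeff R A n b a k))"

end

theory Submission
  imports Defs "HOL-Algebra.Subrings"
begin

text \<open>Let \<open>A = R[x]/(f)\<close>, let \<open>\<alpha>\<close> be the class of \<open>x\<close>, let \<open>\<phi>\<close> be a \<open>G\<close>-closure datum and let \<open>J\<close> be an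
orbit of \<open>G\<close> on \<open>{1..n}\<close>. In \<open>A\<^sup>\<otimes>\<^sup>n[X]\<close> form \<open>p\<^sub>J = \<Prod>i\<in>J. (X - \<alpha>^(i))\<close>. Every \<open>\<sigma> \<in> G\<close> permutes
the factors, because it maps \<open>\<alpha>^(i)\<close> to \<open>\<alpha>^(\<sigma> i)\<close> and \<open>J\<close> to itself; so the coefficients of \<open>p\<^sub>J\<close> are
\<open>G\<close>-invariant (\<open>invariant_root_poly\<close>) and \<open>\<phi>\<close> can be applied to them. The same holds for the
complement of \<open>J\<close>. Since \<open>\<phi>\<close> is a ring homomorphism, \<open>\<phi>(p\<^sub>J)\<close> is monic of degree \<open>card J\<close> and divides
the image of the product over all of \<open>{1..n}\<close>. By Vieta's formulas (\<open>coeff_root_poly\<close>) the coefficients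
of that product are \<open>\<plusminus>e\<^sub>k(\<alpha>)\<close>, and \<open>\<phi>\<close> sends \<open>e\<^sub>k(\<alpha>)\<close> to \<open>s\<^sub>k(\<alpha>)\<close>; so its image is the
characteristic polynomial of multiplication by \<open>\<alpha>\<close>. In the basis \<open>1, \<alpha>, \<dots>, \<alpha>^(n-1)\<close> this
multiplication is given by the companion matrix of \<open>f\<close>, so the characteristic polynomial is \<open>f\<close>
(\<open>char_poly_root\<close>). Hence an orbit of size \<open>d\<close> yields a monic divisor of \<open>f\<close> of degree \<open>d\<close>
(\<open>closure_datum_factorization\<close>). A monic divisor of degree strictly between \<open>0\<close> and \<open>n\<close> is neither
a unit nor divisible by \<open>f\<close>, even when \<open>R\<close> has zero divisors, because multiplying by a monic
polynomial adds its degree (\<open>monic_mult_low_degree\<close>). So if \<open>f\<close> is irreducible, every orbit has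
\<open>n\<close> elements.

For this argument the tensor power has to be a commutative ring on which permutations act by
ring homomorphisms. Both facts are proved for the monoid algebra of which the tensor power is a
quotient, and then descend to the quotient.\<close>

section \<open>Monoid algebras of commutative monoids\<close>

lemma (in cring) finsum_swap:
  assumes "finite X" "finite Y" "\<And>x y. x \<in> X \<Longrightarrow> y \<in> Y \<Longrightarrow> h x y \<in> carrier R"
  shows "(\<Oplus>x\<in>X. \<Oplus>y\<in>Y. h x y) = (\<Oplus>y\<in>Y. \<Oplus>x\<in>X. h x y)"
  using assms(1,3)
proof (induction X rule: finite_induct)
  case empty
  then show ?case by simp
next
  case (insert a X)
  have "(\<Oplus>x\<in>insert a X. \<Oplus>y\<in>Y. h x y) = (\<Oplus>y\<in>Y. h a y) \<oplus> (\<Oplus>y\<in>Y. \<Oplus>x\<in>X. h x y)"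
    using insert by (simp add: Pi_def)
  also have "\<dots> = (\<Oplus>y\<in>Y. h a y \<oplus> (\<Oplus>x\<in>X. h x y))"
    using insert.prems by (intro finsum_addf[symmetric]) (auto intro!: finsum_closed)
  also have "\<dots> = (\<Oplus>y\<in>Y. \<Oplus>x\<in>insert a X. h x y)"
    using insert by (intro finsum_cong') (auto simp: Pi_def intro!: finsum_closed)
  finally show ?case .
qed

text \<open>The value at \<open>u\<close> of the linear extension of \<open>g\<close> from basis elements to the free module. The double sum
that defines the product in the monoid algebra is
\<open>(u v)(x) = lin_ext u (\<lambda>y. lin_ext v (\<lambda>z. single x (y z)))\<close> (see \<open>mult_K\<close>), so the ring axioms reduce to
linearity and to the exchange of two linear extensions, and sums over supports are manipulated
only in the proofs of these rules.\<close>

definition lin_ext :: "('r, 'm) ring_scheme \<Rightarrow> ('b \<Rightarrow> 'r) \<Rightarrow> ('b \<Rightarrow> 'r) \<Rightarrow> 'r"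
  where "lin_ext R u g = (\<Oplus>\<^bsub>R\<^esub>y\<in>{y. u y \<noteq> \<zero>\<^bsub>R\<^esub>}. u y \<otimes>\<^bsub>R\<^esub> g y)"

locale comm_monoid_algebra = R?: cring R + M?: comm_monoid M
  for R :: "('r, 'm) ring_scheme" (structure) and M :: "('b, 'd) monoid_scheme" (structure)
begin

abbreviation K where "K \<equiv> monoid_algebra R M"

lemma carrier_K:
  "u \<in> carrier K \<longleftrightarrow> (\<forall>x. u x \<in> carrier R) \<and> finite {x. u x \<noteq> \<zero>\<^bsub>R\<^esub>} \<and>
     {x. u x \<noteq> \<zero>\<^bsub>R\<^esub>} \<subseteq> carrier M"
  by (simp add: monoid_algebra_def)

lemma K_simps:
  "\<zero>\<^bsub>K\<^esub> = (\<lambda>x. \<zero>\<^bsub>R\<^esub>)" "u \<oplus>\<^bsub>K\<^esub> v = (\<lambda>x. u x \<oplus>\<^bsub>R\<^esub> v x)" "\<one>\<^bsub>K\<^esub> = single R \<one>\<^bsub>M\<^esub>"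
  "r \<odot>\<^bsub>K\<^esub> u = (\<lambda>x. r \<otimes>\<^bsub>R\<^esub> u x)"
  by (simp_all add: monoid_algebra_def single_def fun_eq_iff)

lemma K_app: "u \<in> carrier K \<Longrightarrow> u x \<in> carrier R"
  by (simp add: carrier_K)

lemma K_finite: "u \<in> carrier K \<Longrightarrow> finite {x. u x \<noteq> \<zero>\<^bsub>R\<^esub>}"
  by (simp add: carrier_K)

lemma K_supp: "u \<in> carrier K \<Longrightarrow> u x \<noteq> \<zero>\<^bsub>R\<^esub> \<Longrightarrow> x \<in> carrier M"
  by (auto simp add: carrier_K)

lemma single_apply_closed: "single R x y \<in> carrier R"
  by (simp add: single_def)

lemma single_closed: "x \<in> carrier M \<Longrightarrow> single R x \<in> carrier K"
  by (auto simp: carrier_K single_def intro: finite_subset[of _ "{x}"])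

lemma lin_ext_cong:
  assumes "u \<in> carrier K" "\<And>y. y \<in> carrier M \<Longrightarrow> g y = g' y" "\<And>y. y \<in> carrier M \<Longrightarrow> g' y \<in> carrier R"
  shows "lin_ext R u g = lin_ext R u g'"
  unfolding lin_ext_def using assms(2,3) by (intro R.finsum_cong') (auto simp: K_app[OF assms(1)] K_supp[OF assms(1)])

lemma lin_ext_closed:
  assumes "u \<in> carrier K" "\<And>y. y \<in> carrier M \<Longrightarrow> g y \<in> carrier R"
  shows "lin_ext R u g \<in> carrier R"
  unfolding lin_ext_def using assms(2) by (intro R.finsum_closed) (auto simp: K_app[OF assms(1)] K_supp[OF assms(1)])

text \<open>The support of a sum or product is only bounded from above, so sums over larger index sets are
needed before terms can be compared.\<close>

lemma lin_ext_superset: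
  assumes "u \<in> carrier K" "\<And>y. y \<in> carrier M \<Longrightarrow> g y \<in> carrier R"
    and "finite S" "S \<subseteq> carrier M" "\<And>x. u x \<noteq> \<zero>\<^bsub>R\<^esub> \<Longrightarrow> x \<in> S"
  shows "lin_ext R u g = (\<Oplus>\<^bsub>R\<^esub>y\<in>S. u y \<otimes>\<^bsub>R\<^esub> g y)"
  unfolding lin_ext_def using assms
  by (intro R.add.finprod_mono_neutral_cong_left) (auto simp: K_app K_supp subset_iff)

lemma lin_ext_single:
  assumes "x \<in> carrier M" "\<And>y. y \<in> carrier M \<Longrightarrow> g y \<in> carrier R"
  shows "lin_ext R (single R x) g = g x"
proof -
  have "lin_ext R (single R x) g = (\<Oplus>\<^bsub>R\<^esub>y\<in>{x}. single R x y \<otimes>\<^bsub>R\<^esub> g y)"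
    using assms by (intro lin_ext_superset single_closed) (auto simp: single_def split: if_splits)
  then show ?thesis using assms by (simp add: single_def)
qed

lemma lin_ext_by_single:
  assumes u: "u \<in> carrier K"
  shows "lin_ext R u (single R x) = u x"
proof -
  have "lin_ext R u (single R x) = (\<Oplus>\<^bsub>R\<^esub>y\<in>{y. u y \<noteq> \<zero>\<^bsub>R\<^esub>}. if x = y then u y else \<zero>\<^bsub>R\<^esub>)"
    unfolding lin_ext_def using u by (intro R.finsum_cong') (auto simp: single_def K_app)
  also have "\<dots> = u x"
  proof (cases "u x = \<zero>\<^bsub>R\<^esub>")
    case True
    have "(\<Oplus>\<^bsub>R\<^esub>y\<in>{y. u y \<noteq> \<zero>\<^bsub>R\<^esub>}. if x = y then u y else \<zero>\<^bsub>R\<^esub>) = (\<Oplus>\<^bsub>R\<^esub>y\<in>{y. u y \<noteq> \<zero>\<^bsub>R\<^esub>}. \<zero>\<^bsub>R\<^esub>)"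
      using True by (intro R.finsum_cong') auto
    then show ?thesis using True by simp
  next
    case False
    then show ?thesis using u by (intro R.finsum_singleton) (auto simp: K_finite K_app)
  qed
  finally show ?thesis .
qed

lemma add_closed_K:
  assumes "u \<in> carrier K" "v \<in> carrier K"
  shows "(\<lambda>x. u x \<oplus>\<^bsub>R\<^esub> v x) \<in> carrier K"
proof -
  have "{x. u x \<oplus>\<^bsub>R\<^esub> v x \<noteq> \<zero>\<^bsub>R\<^esub>} \<subseteq> {x. u x \<noteq> \<zero>\<^bsub>R\<^esub>} \<union> {x. v x \<noteq> \<zero>\<^bsub>R\<^esub>}"
    by auto
  then show ?thesis
    using assms unfolding carrier_K by (auto intro: finite_subset)
qed

lemma lin_ext_add:
  assumes u: "u \<in> carrier K" and v: "v \<in> carrier K" and g: "\<And>y. y \<in> carrier M \<Longrightarrow> g y \<in> carrier R"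
  shows "lin_ext R (\<lambda>x. u x \<oplus>\<^bsub>R\<^esub> v x) g = lin_ext R u g \<oplus>\<^bsub>R\<^esub> lin_ext R v g"
proof -
  \<comment> \<open>The three supports may differ because of cancellation; compare all sums over this common set.\<close>
  let ?S = "{x. u x \<noteq> \<zero>\<^bsub>R\<^esub>} \<union> {x. v x \<noteq> \<zero>\<^bsub>R\<^esub>}"
  have S: "finite ?S" "?S \<subseteq> carrier M" using u v by (auto simp: carrier_K)
  have "lin_ext R (\<lambda>x. u x \<oplus>\<^bsub>R\<^esub> v x) g = (\<Oplus>\<^bsub>R\<^esub>y\<in>?S. (u y \<oplus>\<^bsub>R\<^esub> v y) \<otimes>\<^bsub>R\<^esub> g y)"
    by (intro lin_ext_superset add_closed_K u v S g) auto
  also have "\<dots> = (\<Oplus>\<^bsub>R\<^esub>y\<in>?S. u y \<otimes>\<^bsub>R\<^esub> g y \<oplus>\<^bsub>R\<^esub> v y \<otimes>\<^bsub>R\<^esub> g y)"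
    using u v g S(2) by (intro R.finsum_cong') (auto simp: R.l_distr K_app subset_iff)
  also have "\<dots> = (\<Oplus>\<^bsub>R\<^esub>y\<in>?S. u y \<otimes>\<^bsub>R\<^esub> g y) \<oplus>\<^bsub>R\<^esub> (\<Oplus>\<^bsub>R\<^esub>y\<in>?S. v y \<otimes>\<^bsub>R\<^esub> g y)"
    using u v g S(2) by (intro R.finsum_addf) (auto simp: K_app subset_iff)
  also have "\<dots> = lin_ext R u g \<oplus>\<^bsub>R\<^esub> lin_ext R v g"
    using lin_ext_superset[OF u g S] lin_ext_superset[OF v g S] by simp
  finally show ?thesis .
qed

lemma lin_ext_swap:
  assumes u: "u \<in> carrier K" and v: "v \<in> carrier K"
    and h: "\<And>y z. y \<in> carrier M \<Longrightarrow> z \<in> carrier M \<Longrightarrow> h y z \<in> carrier R"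
  shows "lin_ext R u (\<lambda>y. lin_ext R v (\<lambda>z. h y z)) = lin_ext R v (\<lambda>z. lin_ext R u (\<lambda>y. h y z))"
proof -
  let ?U = "{y. u y \<noteq> \<zero>\<^bsub>R\<^esub>}" and ?V = "{y. v y \<noteq> \<zero>\<^bsub>R\<^esub>}"
  note cl = K_app[OF u] K_app[OF v] K_supp[OF u] K_supp[OF v]
  have "lin_ext R u (\<lambda>y. lin_ext R v (\<lambda>z. h y z)) = (\<Oplus>\<^bsub>R\<^esub>y\<in>?U. \<Oplus>\<^bsub>R\<^esub>z\<in>?V. u y \<otimes>\<^bsub>R\<^esub> (v z \<otimes>\<^bsub>R\<^esub> h y z))"
    unfolding lin_ext_def using u v h
    by (intro R.finsum_cong' R.finsum_rdistr)
      (auto simp: cl K_finite intro!: R.finsum_closed)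
  also have "\<dots> = (\<Oplus>\<^bsub>R\<^esub>z\<in>?V. \<Oplus>\<^bsub>R\<^esub>y\<in>?U. u y \<otimes>\<^bsub>R\<^esub> (v z \<otimes>\<^bsub>R\<^esub> h y z))"
    using u v h by (intro R.finsum_swap) (auto simp: cl K_finite)
  also have "\<dots> = (\<Oplus>\<^bsub>R\<^esub>z\<in>?V. \<Oplus>\<^bsub>R\<^esub>y\<in>?U. v z \<otimes>\<^bsub>R\<^esub> (u y \<otimes>\<^bsub>R\<^esub> h y z))"
    using u v h by (intro R.finsum_cong')
       (auto simp: cl K_finite R.m_lcomm intro!: R.finsum_closed)
  also have "\<dots> = lin_ext R v (\<lambda>z. lin_ext R u (\<lambda>y. h y z))"
    unfolding lin_ext_def using u v h
    by (intro R.finsum_cong' R.finsum_rdistr[symmetric])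
      (auto simp: cl K_finite intro!: R.finsum_closed)
  finally show ?thesis .
qed

lemma mult_K:
  assumes u: "u \<in> carrier K" and v: "v \<in> carrier K"
  shows "(u \<otimes>\<^bsub>K\<^esub> v) x = lin_ext R u (\<lambda>y. lin_ext R v (\<lambda>z. single R x (y \<otimes>\<^bsub>M\<^esub> z)))"
proof -
  let ?U = "{y. u y \<noteq> \<zero>\<^bsub>R\<^esub>}" and ?V = "{y. v y \<noteq> \<zero>\<^bsub>R\<^esub>}"
  have "(u \<otimes>\<^bsub>K\<^esub> v) x = (\<Oplus>\<^bsub>R\<^esub>y\<in>?U. \<Oplus>\<^bsub>R\<^esub>z\<in>?V. if y \<otimes>\<^bsub>M\<^esub> z = x then u y \<otimes>\<^bsub>R\<^esub> v z else \<zero>\<^bsub>R\<^esub>)"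
    by (simp add: monoid_algebra_def)
  also have "\<dots> = (\<Oplus>\<^bsub>R\<^esub>y\<in>?U. \<Oplus>\<^bsub>R\<^esub>z\<in>?V. u y \<otimes>\<^bsub>R\<^esub> (v z \<otimes>\<^bsub>R\<^esub> single R x (y \<otimes>\<^bsub>M\<^esub> z)))"
    using u v by (intro R.finsum_cong') (auto simp: K_app single_def intro!: R.finsum_closed)
  also have "\<dots> = (\<Oplus>\<^bsub>R\<^esub>y\<in>?U. u y \<otimes>\<^bsub>R\<^esub> (\<Oplus>\<^bsub>R\<^esub>z\<in>?V. v z \<otimes>\<^bsub>R\<^esub> single R x (y \<otimes>\<^bsub>M\<^esub> z)))"
    using u v by (intro R.finsum_cong' R.finsum_rdistr[symmetric])
      (auto simp: K_app K_finite single_apply_closed intro!: R.finsum_closed)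
  finally show ?thesis by (simp add: lin_ext_def)
qed

lemma mult_supp:
  assumes "u \<in> carrier K" "v \<in> carrier K" "(u \<otimes>\<^bsub>K\<^esub> v) x \<noteq> \<zero>\<^bsub>R\<^esub>"
  shows "x \<in> (\<lambda>(y, z). y \<otimes>\<^bsub>M\<^esub> z) ` ({y. u y \<noteq> \<zero>\<^bsub>R\<^esub>} \<times> {z. v z \<noteq> \<zero>\<^bsub>R\<^esub>})"
proof (rule ccontr)
  assume x: "\<not> ?thesis"
  let ?U = "{y. u y \<noteq> \<zero>\<^bsub>R\<^esub>}" and ?V = "{y. v y \<noteq> \<zero>\<^bsub>R\<^esub>}"
  have "(u \<otimes>\<^bsub>K\<^esub> v) x = (\<Oplus>\<^bsub>R\<^esub>y\<in>?U. \<Oplus>\<^bsub>R\<^esub>z\<in>?V. if y \<otimes>\<^bsub>M\<^esub> z = x then u y \<otimes>\<^bsub>R\<^esub> v z else \<zero>\<^bsub>R\<^esub>)"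
    by (simp add: monoid_algebra_def)
  also have "\<dots> = (\<Oplus>\<^bsub>R\<^esub>y\<in>?U. \<Oplus>\<^bsub>R\<^esub>z\<in>?V. \<zero>\<^bsub>R\<^esub>)"
  proof (intro R.finsum_cong' refl)
    fix y z assume "y \<in> ?U" "z \<in> ?V"
    then have "y \<otimes>\<^bsub>M\<^esub> z \<noteq> x" using x by force
    then show "(if y \<otimes>\<^bsub>M\<^esub> z = x then u y \<otimes>\<^bsub>R\<^esub> v z else \<zero>\<^bsub>R\<^esub>) = \<zero>\<^bsub>R\<^esub>" by simp
  qed auto
  also have "\<dots> = \<zero>\<^bsub>R\<^esub>" by simp
  finally show False using assms(3) by simp
qed

lemma mult_closed_K:
  assumes u: "u \<in> carrier K" and v: "v \<in> carrier K"
  shows "u \<otimes>\<^bsub>K\<^esub> v \<in> carrier K"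
  unfolding carrier_K
proof (intro conjI allI)
  fix x show "(u \<otimes>\<^bsub>K\<^esub> v) x \<in> carrier R"
    unfolding mult_K[OF u v] using u v by (intro lin_ext_closed) (auto simp: single_apply_closed)
next
  have s: "{x. (u \<otimes>\<^bsub>K\<^esub> v) x \<noteq> \<zero>\<^bsub>R\<^esub>}
      \<subseteq> (\<lambda>(y, z). y \<otimes>\<^bsub>M\<^esub> z) ` ({y. u y \<noteq> \<zero>\<^bsub>R\<^esub>} \<times> {z. v z \<noteq> \<zero>\<^bsub>R\<^esub>})"
    using mult_supp[OF u v] by blast
  show "finite {x. (u \<otimes>\<^bsub>K\<^esub> v) x \<noteq> \<zero>\<^bsub>R\<^esub>}"
    by (rule finite_subset[OF s]) (use u v in \<open>auto simp: K_finite\<close>)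
  show "{x. (u \<otimes>\<^bsub>K\<^esub> v) x \<noteq> \<zero>\<^bsub>R\<^esub>} \<subseteq> carrier M"
    using s by (auto simp: K_supp[OF u] K_supp[OF v] dest!: subsetD)
qed

text \<open>The linear extension of \<open>g\<close> to a product is the bilinear extension of \<open>(y, z) \<mapsto> g (y z)\<close>: group the
pairs \<open>(y, z)\<close> by their product \<open>p\<close>. Applied twice, this identity gives associativity.\<close>

lemma lin_ext_mult:
  assumes u: "u \<in> carrier K" and v: "v \<in> carrier K" and g: "\<And>y. y \<in> carrier M \<Longrightarrow> g y \<in> carrier R"
  shows "lin_ext R (u \<otimes>\<^bsub>K\<^esub> v) g = lin_ext R u (\<lambda>y. lin_ext R v (\<lambda>z. g (y \<otimes>\<^bsub>M\<^esub> z)))"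
proof -
  let ?U = "{y. u y \<noteq> \<zero>\<^bsub>R\<^esub>}" and ?V = "{y. v y \<noteq> \<zero>\<^bsub>R\<^esub>}"
  let ?D = "(\<lambda>(y, z). y \<otimes>\<^bsub>M\<^esub> z) ` (?U \<times> ?V)"
  have fin: "finite ?U" "finite ?V" "finite ?D" using u v by (auto simp: K_finite)
  have UM: "y \<in> carrier M" if "y \<in> ?U" for y using that by (simp add: K_supp[OF u])
  have VM: "y \<in> carrier M" if "y \<in> ?V" for y using that by (simp add: K_supp[OF v])
  have D: "?D \<subseteq> carrier M" by (auto simp: K_supp[OF u] K_supp[OF v])
  have gD: "g p \<in> carrier R" if "p \<in> ?D" for p using D g that by blast
  note cl = K_app[OF u] K_app[OF v] single_apply_closed
  have "lin_ext R (u \<otimes>\<^bsub>K\<^esub> v) g = (\<Oplus>\<^bsub>R\<^esub>p\<in>?D. (u \<otimes>\<^bsub>K\<^esub> v) p \<otimes>\<^bsub>R\<^esub> g p)"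
    by (rule lin_ext_superset[OF mult_closed_K[OF u v] g fin(3) D mult_supp[OF u v]])
  also have "\<dots> = (\<Oplus>\<^bsub>R\<^esub>p\<in>?D. \<Oplus>\<^bsub>R\<^esub>y\<in>?U. \<Oplus>\<^bsub>R\<^esub>z\<in>?V. u y \<otimes>\<^bsub>R\<^esub> (v z \<otimes>\<^bsub>R\<^esub> single R p (y \<otimes>\<^bsub>M\<^esub> z)) \<otimes>\<^bsub>R\<^esub> g p)"
  proof (rule R.finsum_cong'[OF refl])
    fix p assume p: "p \<in> ?D"
    have "(u \<otimes>\<^bsub>K\<^esub> v) p \<otimes>\<^bsub>R\<^esub> g p
        = (\<Oplus>\<^bsub>R\<^esub>y\<in>?U. \<Oplus>\<^bsub>R\<^esub>z\<in>?V. u y \<otimes>\<^bsub>R\<^esub> (v z \<otimes>\<^bsub>R\<^esub> single R p (y \<otimes>\<^bsub>M\<^esub> z))) \<otimes>\<^bsub>R\<^esub> g p"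
      unfolding mult_K[OF u v] lin_ext_def
      by (intro arg_cong2[where f = "(\<otimes>\<^bsub>R\<^esub>)"] R.finsum_cong' R.finsum_rdistr refl fin)
        (auto intro!: R.finsum_closed simp: cl)
    also have "\<dots> = (\<Oplus>\<^bsub>R\<^esub>y\<in>?U. (\<Oplus>\<^bsub>R\<^esub>z\<in>?V. u y \<otimes>\<^bsub>R\<^esub> (v z \<otimes>\<^bsub>R\<^esub> single R p (y \<otimes>\<^bsub>M\<^esub> z))) \<otimes>\<^bsub>R\<^esub> g p)"
      using fin gD[OF p] by (intro R.finsum_ldistr) (auto intro!: R.finsum_closed simp: cl)
    also have "\<dots> = (\<Oplus>\<^bsub>R\<^esub>y\<in>?U. \<Oplus>\<^bsub>R\<^esub>z\<in>?V. u y \<otimes>\<^bsub>R\<^esub> (v z \<otimes>\<^bsub>R\<^esub> single R p (y \<otimes>\<^bsub>M\<^esub> z)) \<otimes>\<^bsub>R\<^esub> g p)"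
      using fin gD[OF p] by (intro R.finsum_cong' R.finsum_ldistr refl) (auto intro!: R.finsum_closed simp: cl)
    finally show "(u \<otimes>\<^bsub>K\<^esub> v) p \<otimes>\<^bsub>R\<^esub> g p
      = (\<Oplus>\<^bsub>R\<^esub>y\<in>?U. \<Oplus>\<^bsub>R\<^esub>z\<in>?V. u y \<otimes>\<^bsub>R\<^esub> (v z \<otimes>\<^bsub>R\<^esub> single R p (y \<otimes>\<^bsub>M\<^esub> z)) \<otimes>\<^bsub>R\<^esub> g p)" .
  qed (use gD in \<open>auto intro!: R.finsum_closed simp: cl\<close>)
  also have "\<dots> = (\<Oplus>\<^bsub>R\<^esub>y\<in>?U. \<Oplus>\<^bsub>R\<^esub>p\<in>?D. \<Oplus>\<^bsub>R\<^esub>z\<in>?V. u y \<otimes>\<^bsub>R\<^esub> (v z \<otimes>\<^bsub>R\<^esub> single R p (y \<otimes>\<^bsub>M\<^esub> z)) \<otimes>\<^bsub>R\<^esub> g p)"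
    using fin gD by (intro R.finsum_swap) (auto intro!: R.finsum_closed simp: cl)
  also have "\<dots> = (\<Oplus>\<^bsub>R\<^esub>y\<in>?U. \<Oplus>\<^bsub>R\<^esub>z\<in>?V. \<Oplus>\<^bsub>R\<^esub>p\<in>?D. u y \<otimes>\<^bsub>R\<^esub> (v z \<otimes>\<^bsub>R\<^esub> single R p (y \<otimes>\<^bsub>M\<^esub> z)) \<otimes>\<^bsub>R\<^esub> g p)"
    using fin gD by (intro R.finsum_cong' R.finsum_swap refl) (auto intro!: R.finsum_closed simp: cl)
  also have "\<dots> = (\<Oplus>\<^bsub>R\<^esub>y\<in>?U. \<Oplus>\<^bsub>R\<^esub>z\<in>?V. u y \<otimes>\<^bsub>R\<^esub> (v z \<otimes>\<^bsub>R\<^esub> g (y \<otimes>\<^bsub>M\<^esub> z)))"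
  proof (intro R.finsum_cong' refl)
    fix y z assume yz: "y \<in> ?U" "z \<in> ?V"
    then have yzD: "y \<otimes>\<^bsub>M\<^esub> z \<in> ?D" by force
    have "(\<Oplus>\<^bsub>R\<^esub>p\<in>?D. u y \<otimes>\<^bsub>R\<^esub> (v z \<otimes>\<^bsub>R\<^esub> single R p (y \<otimes>\<^bsub>M\<^esub> z)) \<otimes>\<^bsub>R\<^esub> g p)
        = (\<Oplus>\<^bsub>R\<^esub>p\<in>?D. if y \<otimes>\<^bsub>M\<^esub> z = p then u y \<otimes>\<^bsub>R\<^esub> (v z \<otimes>\<^bsub>R\<^esub> g p) else \<zero>\<^bsub>R\<^esub>)"
      using gD by (intro R.finsum_cong') (auto simp: single_def cl R.m_assoc)
    also have "\<dots> = u y \<otimes>\<^bsub>R\<^esub> (v z \<otimes>\<^bsub>R\<^esub> g (y \<otimes>\<^bsub>M\<^esub> z))"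
      using gD fin yzD by (intro R.finsum_singleton) (auto simp: cl)
    finally show "(\<Oplus>\<^bsub>R\<^esub>p\<in>?D. u y \<otimes>\<^bsub>R\<^esub> (v z \<otimes>\<^bsub>R\<^esub> single R p (y \<otimes>\<^bsub>M\<^esub> z)) \<otimes>\<^bsub>R\<^esub> g p)
      = u y \<otimes>\<^bsub>R\<^esub> (v z \<otimes>\<^bsub>R\<^esub> g (y \<otimes>\<^bsub>M\<^esub> z))" .
  qed (use g UM VM in \<open>auto intro!: R.finsum_closed simp: cl\<close>)
  also have "\<dots> = lin_ext R u (\<lambda>y. lin_ext R v (\<lambda>z. g (y \<otimes>\<^bsub>M\<^esub> z)))"
    unfolding lin_ext_def using g UM VM fin
    by (intro R.finsum_cong' R.finsum_rdistr[symmetric] refl) (auto intro!: R.finsum_closed simp: cl)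
  finally show ?thesis .
qed

lemma K_cring: "cring K"
proof (rule cringI)
  show "abelian_group K"
  proof (rule abelian_groupI)
    fix u v w assume u: "u \<in> carrier K" and v: "v \<in> carrier K" and w: "w \<in> carrier K"
    show "u \<oplus>\<^bsub>K\<^esub> v \<in> carrier K" using add_closed_K[OF u v] by (simp add: K_simps)
    show "(u \<oplus>\<^bsub>K\<^esub> v) \<oplus>\<^bsub>K\<^esub> w = u \<oplus>\<^bsub>K\<^esub> (v \<oplus>\<^bsub>K\<^esub> w)"
      using u v w by (simp add: K_simps K_app R.a_assoc)
    show "u \<oplus>\<^bsub>K\<^esub> v = v \<oplus>\<^bsub>K\<^esub> u"
      using u v by (simp add: K_simps K_app R.a_comm)
  next
    fix u assume u: "u \<in> carrier K"
    show "\<zero>\<^bsub>K\<^esub> \<oplus>\<^bsub>K\<^esub> u = u" using u by (auto simp: K_simps K_app)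
    show "\<exists>v\<in>carrier K. v \<oplus>\<^bsub>K\<^esub> u = \<zero>\<^bsub>K\<^esub>"
    proof
      have "{x. \<ominus>\<^bsub>R\<^esub> u x \<noteq> \<zero>\<^bsub>R\<^esub>} \<subseteq> {x. u x \<noteq> \<zero>\<^bsub>R\<^esub>}" by auto
      then show "(\<lambda>x. \<ominus>\<^bsub>R\<^esub> u x) \<in> carrier K" using u unfolding carrier_K by (auto intro: finite_subset)
      show "(\<lambda>x. \<ominus>\<^bsub>R\<^esub> u x) \<oplus>\<^bsub>K\<^esub> u = \<zero>\<^bsub>K\<^esub>" using u by (auto simp: K_simps K_app R.l_neg)
    qed
  qed (auto simp: K_simps carrier_K)
  show "Group.comm_monoid K"
  proof (rule comm_monoidI)
    fix u v w assume u: "u \<in> carrier K" and v: "v \<in> carrier K" and w: "w \<in> carrier K"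
    show "u \<otimes>\<^bsub>K\<^esub> v \<in> carrier K" by (rule mult_closed_K[OF u v])
    show "u \<otimes>\<^bsub>K\<^esub> v \<otimes>\<^bsub>K\<^esub> w = u \<otimes>\<^bsub>K\<^esub> (v \<otimes>\<^bsub>K\<^esub> w)"
    proof
      fix x
      have "(u \<otimes>\<^bsub>K\<^esub> v \<otimes>\<^bsub>K\<^esub> w) x
          = lin_ext R u (\<lambda>y. lin_ext R v (\<lambda>z. lin_ext R w (\<lambda>t. single R x (y \<otimes>\<^bsub>M\<^esub> z \<otimes>\<^bsub>M\<^esub> t))))"
        unfolding mult_K[OF mult_closed_K[OF u v] w]
        by (rule lin_ext_mult[OF u v]) (auto intro!: lin_ext_closed w simp: single_apply_closed)
      also have "\<dots> = lin_ext R u (\<lambda>y. lin_ext R v (\<lambda>z. lin_ext R w (\<lambda>t. single R x (y \<otimes>\<^bsub>M\<^esub> (z \<otimes>\<^bsub>M\<^esub> t)))))"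
        by (intro lin_ext_cong u v w lin_ext_closed) (auto simp: single_apply_closed M.m_assoc)
      also have "\<dots> = (u \<otimes>\<^bsub>K\<^esub> (v \<otimes>\<^bsub>K\<^esub> w)) x"
        unfolding mult_K[OF u mult_closed_K[OF v w]]
        by (intro lin_ext_cong u lin_ext_mult[OF v w, symmetric] lin_ext_closed mult_closed_K v w)
          (auto simp: single_apply_closed)
      finally show "(u \<otimes>\<^bsub>K\<^esub> v \<otimes>\<^bsub>K\<^esub> w) x = (u \<otimes>\<^bsub>K\<^esub> (v \<otimes>\<^bsub>K\<^esub> w)) x" .
    qed
    show "u \<otimes>\<^bsub>K\<^esub> v = v \<otimes>\<^bsub>K\<^esub> u"
    proof
      fix x
      have "(u \<otimes>\<^bsub>K\<^esub> v) x = lin_ext R v (\<lambda>z. lin_ext R u (\<lambda>y. single R x (y \<otimes>\<^bsub>M\<^esub> z)))"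
        unfolding mult_K[OF u v] by (rule lin_ext_swap[OF u v]) (rule single_apply_closed)
      also have "\<dots> = (v \<otimes>\<^bsub>K\<^esub> u) x"
        unfolding mult_K[OF v u] by (intro lin_ext_cong u v lin_ext_closed)
          (auto simp: single_apply_closed M.m_comm)
      finally show "(u \<otimes>\<^bsub>K\<^esub> v) x = (v \<otimes>\<^bsub>K\<^esub> u) x" .
    qed
  next
    show one: "\<one>\<^bsub>K\<^esub> \<in> carrier K" by (simp add: K_simps single_closed)
    fix u assume u: "u \<in> carrier K"
    show "\<one>\<^bsub>K\<^esub> \<otimes>\<^bsub>K\<^esub> u = u"
    proof
      fix x
      have "(\<one>\<^bsub>K\<^esub> \<otimes>\<^bsub>K\<^esub> u) x = lin_ext R u (\<lambda>z. single R x (\<one>\<^bsub>M\<^esub> \<otimes>\<^bsub>M\<^esub> z))"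
        unfolding mult_K[OF one u] unfolding K_simps
        by (rule lin_ext_single) (auto intro!: lin_ext_closed u simp: single_apply_closed)
      also have "\<dots> = lin_ext R u (single R x)"
        by (intro lin_ext_cong u) (auto simp: single_apply_closed)
      finally show "(\<one>\<^bsub>K\<^esub> \<otimes>\<^bsub>K\<^esub> u) x = u x" by (simp add: lin_ext_by_single u)
    qed
  qed
  fix u v w assume u: "u \<in> carrier K" and v: "v \<in> carrier K" and w: "w \<in> carrier K"
  show "(u \<oplus>\<^bsub>K\<^esub> v) \<otimes>\<^bsub>K\<^esub> w = u \<otimes>\<^bsub>K\<^esub> w \<oplus>\<^bsub>K\<^esub> v \<otimes>\<^bsub>K\<^esub> w"
    unfolding K_simps
    by (rule ext) (simp add: mult_K add_closed_K u v w lin_ext_add lin_ext_closed single_apply_closed)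
qed

lemma reindex_closed:
  assumes h: "bij h" "\<And>x. h x \<in> carrier M \<longleftrightarrow> x \<in> carrier M" and u: "u \<in> carrier K"
  shows "(\<lambda>x. u (h x)) \<in> carrier K"
proof -
  have "{x. u (h x) \<noteq> \<zero>\<^bsub>R\<^esub>} = h -` {x. u x \<noteq> \<zero>\<^bsub>R\<^esub>}" by auto
  moreover have "finite (h -` {x. u x \<noteq> \<zero>\<^bsub>R\<^esub>})"
    using h(1) K_finite[OF u] by (intro finite_vimageI) (auto simp: bij_def)
  ultimately show ?thesis
    using u h(2) unfolding carrier_K by (auto simp: subset_iff)
qed

lemma lin_ext_reindex:
  assumes h: "bij h" "\<And>x. h x \<in> carrier M \<longleftrightarrow> x \<in> carrier M" and u: "u \<in> carrier K"
    and g: "\<And>x. x \<in> carrier M \<Longrightarrow> g x \<in> carrier R"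
  shows "lin_ext R (\<lambda>x. u (h x)) (\<lambda>x. g (h x)) = lin_ext R u g"
proof -
  have e: "{x. u x \<noteq> \<zero>\<^bsub>R\<^esub>} = h ` {x. u (h x) \<noteq> \<zero>\<^bsub>R\<^esub>}"
    using h(1) by (auto simp: bij_def image_iff surj_def)
  show ?thesis
    unfolding lin_ext_def e using h(1) g
    by (intro R.finsum_reindex[symmetric])
      (auto simp: bij_def inj_on_def K_app[OF u] K_supp[OF u])
qed

text \<open>Functoriality of the monoid algebra, for automorphisms of the monoid only. In terms of
functions the automorphism acts by precomposition with its inverse, here called \<open>h\<close>; since \<open>h\<close> is a
bijection of the whole type, no case distinction between elements inside and outside the carrier arises.\<close>

lemma reindex_hom:
  assumes h: "bij h" "\<And>x. h x \<in> carrier M \<longleftrightarrow> x \<in> carrier M"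
    and h_one: "h \<one>\<^bsub>M\<^esub> = \<one>\<^bsub>M\<^esub>"
    and h_mult: "\<And>x y. x \<in> carrier M \<Longrightarrow> y \<in> carrier M \<Longrightarrow> h (x \<otimes>\<^bsub>M\<^esub> y) = h x \<otimes>\<^bsub>M\<^esub> h y"
  shows "(\<lambda>u x. u (h x)) \<in> ring_hom K K"
proof (rule ring_hom_memI)
  have h_eq: "h x = h y \<longleftrightarrow> x = y" for x y using h(1) by (auto simp: bij_def inj_on_def)
  fix u v assume u: "u \<in> carrier K" and v: "v \<in> carrier K"
  note cl = reindex_closed[OF h]
  show "(\<lambda>x. u (h x)) \<in> carrier K" by (rule cl[OF u])
  show "(\<lambda>x. (u \<oplus>\<^bsub>K\<^esub> v) (h x)) = (\<lambda>x. u (h x)) \<oplus>\<^bsub>K\<^esub> (\<lambda>x. v (h x))" by (simp add: K_simps)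
  show "(\<lambda>x. (u \<otimes>\<^bsub>K\<^esub> v) (h x)) = (\<lambda>x. u (h x)) \<otimes>\<^bsub>K\<^esub> (\<lambda>x. v (h x))"
  proof
    fix x
    have "((\<lambda>x. u (h x)) \<otimes>\<^bsub>K\<^esub> (\<lambda>x. v (h x))) x
        = lin_ext R (\<lambda>x. u (h x)) (\<lambda>y. lin_ext R (\<lambda>x. v (h x)) (\<lambda>z. single R x (y \<otimes>\<^bsub>M\<^esub> z)))"
      by (rule mult_K[OF cl[OF u] cl[OF v]])
    also have "\<dots> = lin_ext R (\<lambda>x. u (h x)) (\<lambda>y. lin_ext R (\<lambda>x. v (h x)) (\<lambda>z. single R (h x) (h y \<otimes>\<^bsub>M\<^esub> h z)))"
      by (intro lin_ext_cong cl u v lin_ext_closed)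
        (simp_all add: single_apply_closed, simp add: single_def h_eq flip: h_mult)
    also have "\<dots> = lin_ext R (\<lambda>x. u (h x)) (\<lambda>y. lin_ext R v (\<lambda>z. single R (h x) (h y \<otimes>\<^bsub>M\<^esub> z)))"
      by (intro lin_ext_cong cl u v lin_ext_closed lin_ext_reindex h) (auto simp: single_apply_closed)
    also have "\<dots> = lin_ext R u (\<lambda>y. lin_ext R v (\<lambda>z. single R (h x) (y \<otimes>\<^bsub>M\<^esub> z)))"
      by (rule lin_ext_reindex[OF h u]) (auto intro!: lin_ext_closed v single_apply_closed)
    finally show "(u \<otimes>\<^bsub>K\<^esub> v) (h x) = ((\<lambda>x. u (h x)) \<otimes>\<^bsub>K\<^esub> (\<lambda>x. v (h x))) x"
      by (simp add: mult_K u v)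
  qed
next
  have "h x = \<one>\<^bsub>M\<^esub> \<longleftrightarrow> x = \<one>\<^bsub>M\<^esub>" for x
    using h(1) h_one by (metis bij_def injD)
  then show "(\<lambda>x. \<one>\<^bsub>K\<^esub> (h x)) = \<one>\<^bsub>K\<^esub>"
    by (simp add: K_simps single_def)
qed

end

section \<open>Tensor powers and their invariants\<close>

text \<open>Being a commutative ring depends only on the five ring fields of the record. This transports the
property from \<open>A Quot I\<close> to records that extend it with a scalar multiplication.\<close>

lemma cring_cong:
  assumes "cring S" and c: "carrier T = carrier S" and m: "mult T = mult S" and o: "one T = one S"
    and z: "zero T = zero S" and a: "add T = add S"
  shows "cring T"
proof -
  interpret cring S by fact
  show ?thesis
  proof (rule cringI)
    show "abelian_group T"
    proof (rule abelian_groupI)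
      fix x y w assume "x \<in> carrier T" "y \<in> carrier T" "w \<in> carrier T"
      then show "x \<oplus>\<^bsub>T\<^esub> y \<oplus>\<^bsub>T\<^esub> w = x \<oplus>\<^bsub>T\<^esub> (y \<oplus>\<^bsub>T\<^esub> w)" by (simp add: c a a_assoc)
    next
      fix x y assume "x \<in> carrier T" "y \<in> carrier T"
      then show "x \<oplus>\<^bsub>T\<^esub> y = y \<oplus>\<^bsub>T\<^esub> x" by (simp add: c a a_comm)
    qed (auto simp: c z a intro: l_neg)
    show "Group.comm_monoid T"
    proof (rule comm_monoidI)
      fix x y assume "x \<in> carrier T" "y \<in> carrier T"
      then show "x \<otimes>\<^bsub>T\<^esub> y = y \<otimes>\<^bsub>T\<^esub> x" by (simp add: c m m_comm)
    qed (auto simp: c m o m_assoc)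
  qed (auto simp: c m a l_distr)
qed

lemma quotient_algebra_cring:
  assumes "cring A" "ideal I A"
  shows "cring (quotient_algebra R A I)"
  by (rule cring_cong[OF ideal.quotient_is_cring[OF assms(2,1)]]) (simp_all add: quotient_algebra_def)

lemma quotient_algebra_proj:
  assumes "ideal I A"
  shows "(+>\<^bsub>A\<^esub>) I \<in> ring_hom A (quotient_algebra R A I)"
  using ideal.rcos_ring_hom[OF assms] by (simp add: ring_hom_def quotient_algebra_def)

lemma quotient_algebra_carrier:
  "carrier (quotient_algebra R A I) = (+>\<^bsub>A\<^esub>) I ` carrier A"
  by (auto simp: quotient_algebra_def FactRing_def A_RCOSETS_def' )

lemma (in ideal) rcos_eq_iff:
  assumes "x \<in> carrier R" "y \<in> carrier R"
  shows "I +> x = I +> y \<longleftrightarrow> x \<ominus> y \<in> I"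
proof
  assume "I +> x = I +> y"
  then have "x \<in> I +> y" using a_rcos_self[OF assms(1)] by simp
  then show "x \<ominus> y \<in> I" using a_rcos_module[OF assms(2,1)] by (simp add: a_minus_def)
next
  assume "x \<ominus> y \<in> I"
  then have "x \<in> I +> y" using a_rcos_module[OF assms(2,1)] by (simp add: a_minus_def)
  then show "I +> x = I +> y" using a_repr_independence[OF _ assms(2)] a_subgroup by simp
qed

lemma comm_monoid_product:
  assumes "\<And>i. i \<in> J \<Longrightarrow> comm_monoid (G i)"
  shows "comm_monoid (product_group J G)"
proof (rule comm_monoidI)
  note G = comm_monoid.axioms(1)[OF assms]
  fix x y z
  assume x: "x \<in> carrier (product_group J G)" and y: "y \<in> carrier (product_group J G)"
    and z: "z \<in> carrier (product_group J G)"
  show "x \<otimes>\<^bsub>product_group J G\<^esub> y \<in> carrier (product_group J G)"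
    using x y by (auto simp: PiE_iff monoid.m_closed[OF G])
  show "x \<otimes>\<^bsub>product_group J G\<^esub> y \<otimes>\<^bsub>product_group J G\<^esub> z = x \<otimes>\<^bsub>product_group J G\<^esub> (y \<otimes>\<^bsub>product_group J G\<^esub> z)"
    using x y z by (auto simp: PiE_iff monoid.m_assoc[OF G])
  show "x \<otimes>\<^bsub>product_group J G\<^esub> y = y \<otimes>\<^bsub>product_group J G\<^esub> x"
    using x y by (auto simp: PiE_iff comm_monoid.m_comm[OF assms])
  show "\<one>\<^bsub>product_group J G\<^esub> \<otimes>\<^bsub>product_group J G\<^esub> x = x"
    using x by (auto simp: PiE_iff extensional_def monoid.l_one[OF G])
next
  show "\<one>\<^bsub>product_group J G\<^esub> \<in> carrier (product_group J G)" by (auto simp: monoid.one_closed[OF comm_monoid.axioms(1)[OF assms]])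
qed

text \<open>Closure of \<open>A\<close> under scalar multiplication makes the multilinearity relators elements of the
free module, so that they generate an ideal of it.\<close>

locale algebra_tensor_power = R?: cring R + A?: cring A
  for R :: "('r, 'm) ring_scheme" (structure) and A :: "('r, 'a, 'c) module_scheme" (structure) +
  fixes n :: nat
  assumes smult_closed_A: "r \<in> carrier R \<Longrightarrow> x \<in> carrier A \<Longrightarrow> r \<odot>\<^bsub>A\<^esub> x \<in> carrier A"
begin

abbreviation "M \<equiv> product_group {1..n} (\<lambda>_. A)"
abbreviation "F \<equiv> free_tensor R A n"
abbreviation "I \<equiv> tensor_ideal R A n"
abbreviation "T \<equiv> tensor_power R A n"
abbreviation "permute \<sigma> \<equiv> (\<lambda>u (a :: nat \<Rightarrow> 'a). u (a \<circ> \<sigma>))"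

sublocale F: comm_monoid_algebra R M
  rewrites "monoid_algebra R M = F"
proof -
  show "comm_monoid_algebra R M"
    by (intro comm_monoid_algebra.intro R.is_cring comm_monoid_product) unfold_locales
qed (simp add: free_tensor_def)

sublocale F: cring F by (rule F.K_cring)

lemma single_mem: "a \<in> {1..n} \<rightarrow>\<^sub>E carrier A \<Longrightarrow> single R a \<in> carrier F"
  using F.single_closed by simp

lemma update_mem:
  "a \<in> {1..n} \<rightarrow>\<^sub>E carrier A \<Longrightarrow> i \<in> {1..n} \<Longrightarrow> x \<in> carrier A \<Longrightarrow> a(i := x) \<in> {1..n} \<rightarrow>\<^sub>E carrier A"
  by (auto simp: PiE_iff extensional_def)

lemma smult_mem: "r \<in> carrier R \<Longrightarrow> u \<in> carrier F \<Longrightarrow> r \<odot>\<^bsub>F\<^esub> u \<in> carrier F"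
proof -
  assume r: "r \<in> carrier R" and u: "u \<in> carrier F"
  have "{x. r \<otimes> u x \<noteq> \<zero>} \<subseteq> {x. u x \<noteq> \<zero>}" using r by auto
  then show ?thesis using r u unfolding F.carrier_K F.K_simps by (auto intro: finite_subset)
qed

lemma relators_closed: "multilinear_relators R A n \<subseteq> carrier F"
  unfolding multilinear_relators_def
  by (auto intro!: F.minus_closed F.a_closed smult_mem single_mem update_mem smult_closed_A
      simp del: F.K_simps)

sublocale I: ideal I F
  unfolding tensor_ideal_def by (rule F.genideal_ideal[OF relators_closed])

sublocale T: cring T
  unfolding tensor_power_def by (rule quotient_algebra_cring[OF F.is_cring I.is_ideal])

lemma proj_hom: "(+>\<^bsub>F\<^esub>) I \<in> ring_hom F T"
  unfolding tensor_power_def by (rule quotient_algebra_proj[OF I.is_ideal])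

lemma carrier_T: "carrier T = (+>\<^bsub>F\<^esub>) I ` carrier F"
  unfolding tensor_power_def by (rule quotient_algebra_carrier)

lemma const_mem: "x \<in> carrier A \<Longrightarrow> (\<lambda>j\<in>{1..n}. if j = i then x else \<one>\<^bsub>A\<^esub>) \<in> {1..n} \<rightarrow>\<^sub>E carrier A"
  by auto

lemma embed_closed: "x \<in> carrier A \<Longrightarrow> tensor_embed R A n i x \<in> carrier T"
  unfolding carrier_T tensor_embed_def pure_tensor_def by (intro imageI single_mem const_mem)

context
  fixes \<sigma> assumes perm: "\<sigma> permutes {1..n}"
begin

lemma bij_comp: "bij (\<lambda>a :: nat \<Rightarrow> 'a. a \<circ> \<sigma>)"
  by (rule bij_betw_byWitness[of _ "\<lambda>a. a \<circ> inv' \<sigma>"])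
    (auto simp: comp_assoc permutes_inv_o[OF perm])

lemma comp_mem: "a \<circ> \<sigma> \<in> {1..n} \<rightarrow>\<^sub>E carrier A \<longleftrightarrow> a \<in> {1..n} \<rightarrow>\<^sub>E carrier A"
proof -
  have *: "a \<circ> \<tau> \<in> {1..n} \<rightarrow>\<^sub>E carrier A" if "\<tau> permutes {1..n}" "a \<in> {1..n} \<rightarrow>\<^sub>E carrier A" for \<tau> a
    using that permutes_in_image[OF that(1)] permutes_not_in[OF that(1)]
    by (auto simp: PiE_iff extensional_def)
  show ?thesis
    using *[OF perm] *[OF permutes_inv[OF perm], of "a \<circ> \<sigma>"]
    by (auto simp: comp_assoc permutes_inv_o[OF perm])
qed

lemma permute_hom: "permute \<sigma> \<in> ring_hom F F"
proof (rule F.reindex_hom[where h = "\<lambda>a. a \<circ> \<sigma>", OF bij_comp])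
  have p: "\<sigma> j \<in> {1..n} \<longleftrightarrow> j \<in> {1..n}" for j by (rule permutes_in_image[OF perm])
  show "a \<circ> \<sigma> \<in> carrier M \<longleftrightarrow> a \<in> carrier M" for a using comp_mem by simp
  show "\<one>\<^bsub>M\<^esub> \<circ> \<sigma> = \<one>\<^bsub>M\<^esub>" using p by (auto simp: fun_eq_iff)
  show "(x \<otimes>\<^bsub>M\<^esub> y) \<circ> \<sigma> = (x \<circ> \<sigma>) \<otimes>\<^bsub>M\<^esub> (y \<circ> \<sigma>)" for x y using p by (auto simp: fun_eq_iff)
qed

lemma permute_single: "permute \<sigma> (single R a) = single R (a \<circ> inv' \<sigma>)"
proof -
  have "b \<circ> \<sigma> = a \<longleftrightarrow> b = a \<circ> inv' \<sigma>" for b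
    using permutes_inv_o[OF perm] by (metis comp_assoc comp_id)
  then show ?thesis by (simp add: single_def)
qed

lemma update_comp_inv: "a(i := x) \<circ> inv' \<sigma> = (a \<circ> inv' \<sigma>)(\<sigma> i := x)"
  using permutes_inverses[OF perm] by (auto simp: fun_eq_iff)

end

text \<open>Permuting the positions turns the relator at position \<open>i\<close> into the relator of the same kind at position
\<open>\<sigma> i\<close>. This is why the ideal is stable and the action descends to the tensor power.\<close>

lemma permute_relators:
  assumes "\<sigma> permutes {1..n}" "u \<in> multilinear_relators R A n"
  shows "permute \<sigma> u \<in> multilinear_relators R A n"
proof -
  interpret h: ring_hom_cring F F "permute \<sigma>"
    by unfold_locales (rule permute_hom[OF assms(1)])
  have hm: "permute \<sigma> (v \<ominus>\<^bsub>F\<^esub> w) = permute \<sigma> v \<ominus>\<^bsub>F\<^esub> permute \<sigma> w" if "v \<in> carrier F" "w \<in> carrier F" for v w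
    unfolding a_minus_def
    using h.hom_add[of v "\<ominus>\<^bsub>F\<^esub> w"] h.hom_a_inv[of w] that by simp
  have hp: "permute \<sigma> (v \<oplus>\<^bsub>F\<^esub> w) = permute \<sigma> v \<oplus>\<^bsub>F\<^esub> permute \<sigma> w" if "v \<in> carrier F" "w \<in> carrier F" for v w
    using h.hom_add that by simp
  have hs: "permute \<sigma> (r \<odot>\<^bsub>F\<^esub> v) = r \<odot>\<^bsub>F\<^esub> permute \<sigma> v" for r v
    by (simp add: F.K_simps)
  note upd = permute_single[OF assms(1)] update_comp_inv[OF assms(1)]
  have s: "\<sigma> i \<in> {1..n}" if "i \<in> {1..n}" for i using that permutes_in_image[OF assms(1)] by simp
  have c: "a \<circ> inv' \<sigma> \<in> {1..n} \<rightarrow>\<^sub>E carrier A" if "a \<in> {1..n} \<rightarrow>\<^sub>E carrier A" for a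
    using comp_mem[OF permutes_inv[OF assms(1)]] that by blast
  from assms(2) consider
    (add) a i x y where "u = single R (a(i := x \<oplus>\<^bsub>A\<^esub> y)) \<ominus>\<^bsub>F\<^esub> (single R (a(i := x)) \<oplus>\<^bsub>F\<^esub> single R (a(i := y)))"
       "a \<in> {1..n} \<rightarrow>\<^sub>E carrier A" "i \<in> {1..n}" "x \<in> carrier A" "y \<in> carrier A"
  | (smult) a i r x where "u = single R (a(i := r \<odot>\<^bsub>A\<^esub> x)) \<ominus>\<^bsub>F\<^esub> (r \<odot>\<^bsub>F\<^esub> single R (a(i := x)))"
       "a \<in> {1..n} \<rightarrow>\<^sub>E carrier A" "i \<in> {1..n}" "r \<in> carrier R" "x \<in> carrier A"
    unfolding multilinear_relators_def by blast
  then show ?thesis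
  proof cases
    case add
    note mem = single_mem[OF update_mem[OF add(2,3)]]
    have "permute \<sigma> u = single R ((a \<circ> inv' \<sigma>)(\<sigma> i := x \<oplus>\<^bsub>A\<^esub> y))
        \<ominus>\<^bsub>F\<^esub> (single R ((a \<circ> inv' \<sigma>)(\<sigma> i := x)) \<oplus>\<^bsub>F\<^esub> single R ((a \<circ> inv' \<sigma>)(\<sigma> i := y)))"
      unfolding add(1) upd[symmetric] using mem add(4,5)
      by (simp only: hm hp F.a_closed A.a_closed)
    then show ?thesis
      unfolding multilinear_relators_def using c[OF add(2)] s[OF add(3)] add(4,5) by blast
  next
    case smult
    note mem = single_mem[OF update_mem[OF smult(2,3)]]
    have "permute \<sigma> u = single R ((a \<circ> inv' \<sigma>)(\<sigma> i := r \<odot>\<^bsub>A\<^esub> x))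
        \<ominus>\<^bsub>F\<^esub> (r \<odot>\<^bsub>F\<^esub> single R ((a \<circ> inv' \<sigma>)(\<sigma> i := x)))"
      unfolding smult(1) upd[symmetric] using mem smult(4,5)
      by (simp only: hm hs smult_mem smult_closed_A)
    then show ?thesis
      unfolding multilinear_relators_def using c[OF smult(2)] s[OF smult(3)] smult(4,5) by blast
  qed
qed

lemma permute_ideal_subset:
  assumes "\<sigma> permutes {1..n}" "u \<in> I"
  shows "permute \<sigma> u \<in> I"
proof -
  interpret h: ring_hom_ring F F "permute \<sigma>"
    by (intro ring_hom_ringI2 F.ring_axioms permute_hom[OF assms(1)])
  have "I \<subseteq> {u \<in> carrier F. permute \<sigma> u \<in> I}"
    unfolding tensor_ideal_def
  proof (rule F.genideal_minimal)
    show "ideal {u \<in> carrier F. permute \<sigma> u \<in> Idl\<^bsub>F\<^esub> multilinear_relators R A n} F"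
      by (rule h.ideal_vimage) (rule F.genideal_ideal[OF relators_closed])
    show "multilinear_relators R A n \<subseteq> {u \<in> carrier F. permute \<sigma> u \<in> Idl\<^bsub>F\<^esub> multilinear_relators R A n}"
      using relators_closed F.genideal_self[OF relators_closed] permute_relators[OF assms(1)] by blast
  qed
  then show ?thesis using assms(2) by blast
qed

text \<open>The image of a coset is again a full coset because \<open>\<sigma>\<close> maps the ideal onto itself; surjectivity
comes from the inverse permutation, which also preserves the ideal.\<close>

lemma tensor_perm_coset:
  assumes p: "\<sigma> permutes {1..n}" and u: "u \<in> carrier F"
  shows "tensor_perm \<sigma> (I +>\<^bsub>F\<^esub> u) = I +>\<^bsub>F\<^esub> permute \<sigma> u"
proof -
  have I: "permute \<sigma> ` I = I"
  proof (intro equalityI subsetI)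
    fix v assume v: "v \<in> I"
    have "v = permute \<sigma> (permute (inv' \<sigma>) v)"
      by (simp add: comp_assoc permutes_inv_o[OF p])
    then show "v \<in> permute \<sigma> ` I"
      using permute_ideal_subset[OF permutes_inv[OF p] v] by (rule image_eqI)
  qed (use permute_ideal_subset[OF p] in blast)
  have coset: "I +>\<^bsub>F\<^esub> v = (\<lambda>w. w \<oplus>\<^bsub>F\<^esub> v) ` I" for v
    by (auto simp: a_r_coset_def r_coset_def)
  have "tensor_perm \<sigma> (I +>\<^bsub>F\<^esub> u) = (\<lambda>w. permute \<sigma> w \<oplus>\<^bsub>F\<^esub> permute \<sigma> u) ` I"
    unfolding tensor_perm_def coset image_image by (simp add: F.K_simps)
  also have "\<dots> = (\<lambda>w. w \<oplus>\<^bsub>F\<^esub> permute \<sigma> u) ` (permute \<sigma> ` I)"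
    unfolding image_image ..
  finally show ?thesis unfolding I coset .
qed

lemma tensor_perm_hom:
  assumes p: "\<sigma> permutes {1..n}"
  shows "tensor_perm \<sigma> \<in> ring_hom T T"
proof -
  note h = permute_hom[OF p] and pr = proj_hom
  have key: "tensor_perm \<sigma> (I +>\<^bsub>F\<^esub> u) = I +>\<^bsub>F\<^esub> permute \<sigma> u" if "u \<in> carrier F" for u
    by (rule tensor_perm_coset[OF p that])
  have hc: "permute \<sigma> u \<in> carrier F" if "u \<in> carrier F" for u
    by (rule ring_hom_closed[OF h that])
  show ?thesis
  proof (rule ring_hom_memI)
    fix s t assume "s \<in> carrier T" "t \<in> carrier T"
    then obtain u v where u: "u \<in> carrier F" "s = I +>\<^bsub>F\<^esub> u" and v: "v \<in> carrier F" "t = I +>\<^bsub>F\<^esub> v"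
      unfolding carrier_T by blast
    show "tensor_perm \<sigma> s \<in> carrier T" unfolding u(2) key[OF u(1)] carrier_T using hc[OF u(1)] by blast
    show "tensor_perm \<sigma> (s \<otimes>\<^bsub>T\<^esub> t) = tensor_perm \<sigma> s \<otimes>\<^bsub>T\<^esub> tensor_perm \<sigma> t"
      using ring_hom_mult[OF pr u(1) v(1)] ring_hom_mult[OF pr hc[OF u(1)] hc[OF v(1)]]
        ring_hom_mult[OF h u(1) v(1)] key[OF F.m_closed[OF u(1) v(1)]]
      by (simp add: u v key)
    show "tensor_perm \<sigma> (s \<oplus>\<^bsub>T\<^esub> t) = tensor_perm \<sigma> s \<oplus>\<^bsub>T\<^esub> tensor_perm \<sigma> t"
      using ring_hom_add[OF pr u(1) v(1)] ring_hom_add[OF pr hc[OF u(1)] hc[OF v(1)]]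
        ring_hom_add[OF h u(1) v(1)] key[OF F.a_closed[OF u(1) v(1)]]
      by (simp add: u v key)
  next
    show "tensor_perm \<sigma> \<one>\<^bsub>T\<^esub> = \<one>\<^bsub>T\<^esub>"
      using key[OF F.one_closed] ring_hom_one[OF h] ring_hom_one[OF pr] by simp
  qed
qed

lemma tensor_perm_embed:
  assumes p: "\<sigma> permutes {1..n}" and x: "x \<in> carrier A"
  shows "tensor_perm \<sigma> (tensor_embed R A n i x) = tensor_embed R A n (\<sigma> i) x"
proof -
  have "(\<lambda>j\<in>{1..n}. if j = i then x else \<one>\<^bsub>A\<^esub>) \<circ> inv' \<sigma> = (\<lambda>j\<in>{1..n}. if j = \<sigma> i then x else \<one>\<^bsub>A\<^esub>)"
    using permutes_in_image[OF permutes_inv[OF p]] permutes_inverses[OF p] by (auto simp: fun_eq_iff)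
  then show ?thesis
    unfolding tensor_embed_def pure_tensor_def
    using tensor_perm_coset[OF p single_mem[OF const_mem[OF x]]] permute_single[OF p] by simp
qed

lemma invariants_carrier:
  "t \<in> carrier (tensor_invariants R A n G) \<longleftrightarrow> t \<in> carrier T \<and> (\<forall>\<sigma>\<in>G. tensor_perm \<sigma> t = t)"
  by (simp add: tensor_invariants_def)

lemma invariants_cring:
  assumes G: "\<And>\<sigma>. \<sigma> \<in> G \<Longrightarrow> \<sigma> permutes {1..n}"
  shows "cring (tensor_invariants R A n G)"
proof -
  let ?H = "{t \<in> carrier T. \<forall>\<sigma>\<in>G. tensor_perm \<sigma> t = t}"
  have h: "ring_hom_cring T T (tensor_perm \<sigma>)" if "\<sigma> \<in> G" for \<sigma>
    using tensor_perm_hom[OF G[OF that]] by unfold_locales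
  have "subring ?H T"
    by (rule T.subringI)
      (auto simp: ring_hom_cring.hom_a_inv[OF h] ring_hom_mult[OF tensor_perm_hom[OF G]]
        ring_hom_add[OF tensor_perm_hom[OF G]] ring_hom_one[OF tensor_perm_hom[OF G]])
  then show ?thesis
    unfolding tensor_invariants_def by (simp add: T.subcring_iff[symmetric] T.subcringI')
qed

lemma invariants_incl: "id \<in> ring_hom (tensor_invariants R A n G) T"
  by (rule ring_hom_memI) (auto simp: tensor_invariants_def)

end

section \<open>Polynomials with prescribed roots\<close>

lemma coeff_UP: "p \<in> carrier (UP R) \<Longrightarrow> coeff (UP R) p = p"
  by (simp add: UP_def)

lemma carrier_UP_iff:
  "p \<in> carrier (UP R) \<longleftrightarrow> (\<forall>i. p i \<in> carrier R) \<and> (\<exists>n. \<forall>i>n. p i = \<zero>\<^bsub>R\<^esub>)"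
  by (auto simp: UP_def up_def bound_def)

lemma (in UP_cring) UP_apply:
  assumes "p \<in> carrier P"
  shows "p i \<in> carrier R" "coeff P p i = p i"
  using coeff_closed[OF assms, of i] assms by (simp_all add: P_def coeff_UP)

text \<open>Applying a ring homomorphism to all coefficients. It is used for the inclusion of the invariants into
the tensor power, for the action of a permutation on the tensor power, and for \<open>\<phi>\<close>.\<close>

lemma UP_map_hom:
  assumes "ring_hom_cring S T h"
  shows "(\<lambda>p i. h (p i)) \<in> ring_hom (UP S) (UP T)"
proof -
  interpret ring_hom_cring S T h by fact
  interpret PS: UP_cring S "UP S" by unfold_locales simp
  interpret PT: UP_cring T "UP T" by unfold_locales simp
  have cl: "(\<lambda>i. h (p i)) \<in> carrier (UP T)" if p: "p \<in> carrier (UP S)" for p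
    using p unfolding carrier_UP_iff by force
  show ?thesis
  proof (rule ring_hom_memI)
    fix p q assume p: "p \<in> carrier (UP S)" and q: "q \<in> carrier (UP S)"
    note pc = PS.UP_apply(1)[OF p] and qc = PS.UP_apply(1)[OF q]
    show "(\<lambda>i. h (p i)) \<in> carrier (UP T)" by (rule cl[OF p])
    have "(p \<otimes>\<^bsub>UP S\<^esub> q) i = (\<Oplus>\<^bsub>S\<^esub>j\<in>{..i}. p j \<otimes>\<^bsub>S\<^esub> q (i - j))" for i
      using PS.coeff_mult[OF p q, of i] PS.UP_apply(2)[OF PS.m_closed[OF p q]]
      by (simp add: PS.UP_apply(2) p q)
    moreover have "((\<lambda>i. h (p i)) \<otimes>\<^bsub>UP T\<^esub> (\<lambda>i. h (q i))) i = (\<Oplus>\<^bsub>T\<^esub>j\<in>{..i}. h (p j) \<otimes>\<^bsub>T\<^esub> h (q (i - j)))" for i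
      using PT.coeff_mult[OF cl[OF p] cl[OF q], of i] PT.UP_apply(2)[OF PT.m_closed[OF cl[OF p] cl[OF q]]]
      by (simp add: PT.UP_apply(2) cl p q)
    ultimately show "(\<lambda>i. h ((p \<otimes>\<^bsub>UP S\<^esub> q) i)) = (\<lambda>i. h (p i)) \<otimes>\<^bsub>UP T\<^esub> (\<lambda>i. h (q i))"
      using pc qc by (simp add: fun_eq_iff o_def)
    have "(p \<oplus>\<^bsub>UP S\<^esub> q) i = p i \<oplus>\<^bsub>S\<^esub> q i" for i
      using PS.coeff_add[OF p q, of i] PS.UP_apply(2)[OF PS.a_closed[OF p q]]
      by (simp add: PS.UP_apply(2) p q)
    moreover have "((\<lambda>i. h (p i)) \<oplus>\<^bsub>UP T\<^esub> (\<lambda>i. h (q i))) i = h (p i) \<oplus>\<^bsub>T\<^esub> h (q i)" for i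
      using PT.coeff_add[OF cl[OF p] cl[OF q], of i] PT.UP_apply(2)[OF PT.a_closed[OF cl[OF p] cl[OF q]]]
      by (simp add: PT.UP_apply(2) cl p q)
    ultimately show "(\<lambda>i. h ((p \<oplus>\<^bsub>UP S\<^esub> q) i)) = (\<lambda>i. h (p i)) \<oplus>\<^bsub>UP T\<^esub> (\<lambda>i. h (q i))"
      using pc qc by (simp add: fun_eq_iff)
  next
    show "(\<lambda>i. h (\<one>\<^bsub>UP S\<^esub> i)) = \<one>\<^bsub>UP T\<^esub>"
      by (auto simp: UP_def fun_eq_iff)
  qed
qed

lemma UP_map_monom:
  assumes "ring_hom_cring S T h" "c \<in> carrier S"
  shows "(\<lambda>i. h (monom (UP S) c k i)) = monom (UP T) (h c) k"
proof -
  interpret ring_hom_cring S T h by fact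
  show ?thesis using assms(2) by (auto simp: UP_def fun_eq_iff)
qed

definition root_poly :: "('r, 'm) ring_scheme \<Rightarrow> 'i set \<Rightarrow> ('i \<Rightarrow> 'r) \<Rightarrow> nat \<Rightarrow> 'r"
  where "root_poly S J a = (\<Otimes>\<^bsub>UP S\<^esub>j\<in>J. monom (UP S) \<one>\<^bsub>S\<^esub> 1 \<ominus>\<^bsub>UP S\<^esub> monom (UP S) (a j) 0)"

definition elem_sym :: "('r, 'm) ring_scheme \<Rightarrow> nat \<Rightarrow> 'i set \<Rightarrow> ('i \<Rightarrow> 'r) \<Rightarrow> 'r"
  where "elem_sym S k J a = (\<Oplus>\<^bsub>S\<^esub>K\<in>{K. K \<subseteq> J \<and> card K = k}. \<Otimes>\<^bsub>S\<^esub>j\<in>K. a j)"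

lemma (in UP_cring) root_poly_closed:
  "a \<in> J \<rightarrow> carrier R \<Longrightarrow> root_poly R J a \<in> carrier P"
  unfolding root_poly_def P_def[symmetric] by (intro P.finprod_closed) (auto intro!: P.minus_closed monom_closed)

lemma root_poly_map:
  assumes h: "ring_hom_cring S T h" and a: "a \<in> J \<rightarrow> carrier S"
  shows "(\<lambda>i. h (root_poly S J a i)) = root_poly T J (\<lambda>j. h (a j))"
proof -
  interpret ring_hom_cring S T h by fact
  interpret PS: UP_cring S "UP S" by unfold_locales simp
  interpret PT: UP_cring T "UP T" by unfold_locales simp
  interpret H: ring_hom_cring "UP S" "UP T" "\<lambda>p i. h (p i)"
    by unfold_locales (rule UP_map_hom[OF h])
  let ?l = "\<lambda>j. monom (UP S) \<one>\<^bsub>S\<^esub> 1 \<ominus>\<^bsub>UP S\<^esub> monom (UP S) (a j) 0"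
  have l: "?l \<in> J \<rightarrow> carrier (UP S)" using a by (auto intro!: PS.P.minus_closed PS.monom_closed)
  have "(\<lambda>i. h (?l j i)) = monom (UP T) \<one>\<^bsub>T\<^esub> 1 \<ominus>\<^bsub>UP T\<^esub> monom (UP T) (h (a j)) 0" if "j \<in> J" for j
  proof -
    have aj: "a j \<in> carrier S" using a that by auto
    show ?thesis
      unfolding a_minus_def
      using H.hom_add[of "monom (UP S) \<one>\<^bsub>S\<^esub> 1" "\<ominus>\<^bsub>UP S\<^esub> monom (UP S) (a j) 0"]
        H.hom_a_inv[of "monom (UP S) (a j) 0"] UP_map_monom[OF h, of "\<one>\<^bsub>S\<^esub>" 1] UP_map_monom[OF h aj] aj
      by simp
  qed
  then show ?thesis
    unfolding root_poly_def H.hom_finprod[OF l] using a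
    by (intro PT.P.finprod_cong') (auto intro!: PT.P.minus_closed PT.monom_closed)
qed

lemma (in UP_cring) root_poly_reindex:
  assumes "inj_on s J" "a \<in> s ` J \<rightarrow> carrier R"
  shows "root_poly R (s ` J) a = root_poly R J (\<lambda>j. a (s j))"
  unfolding root_poly_def P_def[symmetric] using assms by (intro P.finprod_reindex) (auto intro!: P.minus_closed monom_closed)

lemma (in UP_cring) root_poly_union:
  assumes "finite J" "finite L" "J \<inter> L = {}" "a \<in> J \<union> L \<rightarrow> carrier R"
  shows "root_poly R (J \<union> L) a = root_poly R J a \<otimes>\<^bsub>P\<^esub> root_poly R L a"
  unfolding root_poly_def P_def[symmetric] using assms by (intro P.finprod_Un_disjoint) (auto intro!: P.minus_closed monom_closed)

lemma (in cring) elem_sym_closed: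
  assumes "a \<in> J \<rightarrow> carrier R"
  shows "elem_sym R k J a \<in> carrier R"
  unfolding elem_sym_def using assms by (intro finsum_closed) (auto intro!: finprod_closed)

lemma (in cring) elem_sym_0: "finite J \<Longrightarrow> elem_sym R 0 J a = \<one>"
proof -
  assume "finite J"
  then have "{K. K \<subseteq> J \<and> card K = 0} = {{}}" by (auto dest: finite_subset)
  then show ?thesis by (simp add: elem_sym_def)
qed

lemma (in cring) elem_sym_large: "finite J \<Longrightarrow> card J < k \<Longrightarrow> elem_sym R k J a = \<zero>"
proof -
  assume J: "finite J" "card J < k"
  have "{K. K \<subseteq> J \<and> card K = k} = {}" using J(2) card_mono[OF J(1)] by (auto dest: leD)
  then show ?thesis unfolding elem_sym_def by (simp only: finsum_empty)
qed

text \<open>A \<open>(k+1)\<close>-subset of \<open>J \<union> {x}\<close> either avoids \<open>x\<close> or arises from a unique \<open>k\<close>-subset of \<open>J\<close> by adding \<open>x\<close>.\<close>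

lemma (in cring) elem_sym_insert:
  assumes J: "finite J" "x \<notin> J" and a: "a \<in> insert x J \<rightarrow> carrier R"
  shows "elem_sym R (Suc k) (insert x J) a = elem_sym R (Suc k) J a \<oplus> a x \<otimes> elem_sym R k J a"
proof -
  let ?U = "{K. K \<subseteq> J \<and> card K = Suc k}" and ?V = "{K. K \<subseteq> J \<and> card K = k}"
  have split: "{K. K \<subseteq> insert x J \<and> card K = Suc k} = ?U \<union> insert x ` ?V"
  proof (intro equalityI subsetI)
    fix K assume K: "K \<in> {K. K \<subseteq> insert x J \<and> card K = Suc k}"
    show "K \<in> ?U \<union> insert x ` ?V"
    proof (cases "x \<in> K")
      case True
      then have "K = insert x (K - {x})" by auto
      moreover have "K - {x} \<in> ?V" using K True J by auto
      ultimately show ?thesis by blast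
    qed (use K in auto)
  next
    fix K assume "K \<in> ?U \<union> insert x ` ?V"
    then show "K \<in> {K. K \<subseteq> insert x J \<and> card K = Suc k}"
      using J finite_subset[OF _ J(1)] by (auto simp: card_insert_if)
  qed
  have disj: "?U \<inter> insert x ` ?V = {}" using J by auto
  have fin: "finite ?U" "finite ?V" using J by auto
  have inj: "inj_on (insert x) ?V" using J(2) by (auto simp: inj_on_def insert_ident)
  have cl: "(\<Otimes>j\<in>K. a j) \<in> carrier R" if "K \<subseteq> insert x J" for K
    using a that by (intro finprod_closed) auto
  have "elem_sym R (Suc k) (insert x J) a
      = (\<Oplus>K\<in>?U. \<Otimes>j\<in>K. a j) \<oplus> (\<Oplus>K\<in>insert x ` ?V. \<Otimes>j\<in>K. a j)"
    unfolding elem_sym_def split using fin disj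
    by (intro finsum_Un_disjoint) (auto intro!: cl)
  also have "(\<Oplus>K\<in>insert x ` ?V. \<Otimes>j\<in>K. a j) = (\<Oplus>K\<in>?V. \<Otimes>j\<in>insert x K. a j)"
    by (rule finsum_reindex[OF _ inj]) (auto intro!: cl)
  also have "\<dots> = (\<Oplus>K\<in>?V. a x \<otimes> (\<Otimes>j\<in>K. a j))"
  proof (rule finsum_cong'[OF refl])
    fix K assume K: "K \<in> ?V"
    then have "finite K" "x \<notin> K" using J by (auto dest: finite_subset)
    then show "(\<Otimes>j\<in>insert x K. a j) = a x \<otimes> (\<Otimes>j\<in>K. a j)"
      using a K by (intro finprod_insert) auto
  qed (use a in \<open>auto intro!: cl m_closed\<close>)
  also have "\<dots> = a x \<otimes> elem_sym R k J a"
    unfolding elem_sym_def using a fin by (intro finsum_rdistr[symmetric]) (auto intro!: cl)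
  finally show ?thesis by (simp add: elem_sym_def)
qed

lemma (in UP_cring) coeff_linear_mult:
  assumes p: "p \<in> carrier P" and b: "b \<in> carrier R"
  shows "coeff P ((monom P \<one> 1 \<ominus>\<^bsub>P\<^esub> monom P b 0) \<otimes>\<^bsub>P\<^esub> p) i
    = (if i = 0 then \<zero> else coeff P p (i - 1)) \<ominus> b \<otimes> coeff P p i"
proof -
  have "(monom P \<one> 1 \<ominus>\<^bsub>P\<^esub> monom P b 0) \<otimes>\<^bsub>P\<^esub> p = (monom P \<one> 1 \<otimes>\<^bsub>P\<^esub> p) \<ominus>\<^bsub>P\<^esub> (b \<odot>\<^bsub>P\<^esub> p)"
    using p b by (simp add: a_minus_def P.l_distr P.l_minus monom_mult_is_smult)
  moreover have "coeff P (monom P \<one> 1 \<otimes>\<^bsub>P\<^esub> p) i = (if i = 0 then \<zero> else coeff P p (i - 1))"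
  proof (cases i)
    case 0
    then show ?thesis using p by simp
  next
    case (Suc k)
    then show ?thesis using coeff_monom_mult[OF R.one_closed p, of 1 k] p by simp
  qed
  ultimately show ?thesis using p b by simp
qed

text \<open>Vieta's formulas. Multiplying by one more factor \<open>X - a\<^sub>x\<close> shifts the coefficients and subtracts \<open>a\<^sub>x\<close>
times them, which matches the recursion of the elementary symmetric polynomials.\<close>

lemma (in UP_cring) coeff_root_poly:
  assumes "finite J" "a \<in> J \<rightarrow> carrier R"
  shows "coeff P (root_poly R J a) i =
    (if i \<le> card J then (\<ominus> \<one>) [^] (card J - i) \<otimes> elem_sym R (card J - i) J a else \<zero>)"
  using assms
proof (induction J arbitrary: i rule: finite_induct)
  case empty
  then show ?case
    by (simp add: root_poly_def P_def[symmetric] R.elem_sym_0)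
next
  case (insert x J)
  let ?p = "root_poly R J a"
  have a: "a \<in> J \<rightarrow> carrier R" and ax: "a x \<in> carrier R" using insert.prems by auto
  have p: "?p \<in> carrier P" by (rule root_poly_closed[OF a])
  have e: "elem_sym R k J a \<in> carrier R" for k by (rule R.elem_sym_closed[OF a])
  have m: "(\<ominus> \<one>) [^] (k::nat) \<in> carrier R" for k by simp
  have rp: "root_poly R (insert x J) a = (monom P \<one> 1 \<ominus>\<^bsub>P\<^esub> monom P (a x) 0) \<otimes>\<^bsub>P\<^esub> ?p"
    unfolding root_poly_def P_def[symmetric]
    by (rule P.finprod_insert[OF insert.hyps]) (use a ax in \<open>auto intro!: P.minus_closed monom_closed\<close>)
  have step: "s \<otimes> e1 \<ominus> b \<otimes> (t \<otimes> e2) = s \<otimes> (e1 \<oplus> b \<otimes> e2)"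
    if "s = \<ominus> t" "t \<in> carrier R" "e1 \<in> carrier R" "e2 \<in> carrier R" "b \<in> carrier R" for s t e1 e2 b
    using that(2-) unfolding that(1) by algebra
  have sgn: "(\<ominus> \<one>) [^] Suc k = \<ominus> ((\<ominus> \<one>) [^] k)" for k :: nat
    using m[of k] by (simp add: R.r_minus)
  note IH = insert.IH[OF a]
  note ins = R.elem_sym_insert[OF insert.hyps insert.prems]
  have c: "card (insert x J) = Suc (card J)" using insert.hyps by simp
  consider "i = 0" | "0 < i" "i \<le> card J" | "i = Suc (card J)" | "i > Suc (card J)" by linarith
  then show ?case
  proof cases
    case 1
    have "\<zero> \<ominus> a x \<otimes> ((\<ominus> \<one>) [^] card J \<otimes> elem_sym R (card J) J a)
        = (\<ominus> \<one>) [^] Suc (card J) \<otimes> (\<zero> \<oplus> a x \<otimes> elem_sym R (card J) J a)"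
      using step[OF sgn[of "card J"] m R.zero_closed e ax] m[of "Suc (card J)"] by simp
    then show ?thesis
      unfolding rp coeff_linear_mult[OF p ax] IH c using 1 ins[of "card J"]
        R.elem_sym_large[OF insert.hyps(1), of "Suc (card J)"] by simp
  next
    case 2
    then obtain k where k: "card J - i = k" "card J - (i - 1) = Suc k" "Suc (card J) - i = Suc k"
        "i - 1 \<le> card J"
      by (auto simp: Suc_diff_le)
    show ?thesis
      unfolding rp coeff_linear_mult[OF p ax] IH c using 2 k ins[of k]
        step[OF sgn[of k] m e e ax, of "Suc k" k] by (simp del: One_nat_def)
  next
    case 3
    then show ?thesis
      unfolding rp coeff_linear_mult[OF p ax] IH c using ax insert.hyps
      by (simp add: R.elem_sym_0 a_minus_def)
  next
    case 4
    then have "\<not> i - 1 \<le> card J" "\<not> i \<le> card J" "\<not> i \<le> Suc (card J)" "i \<noteq> 0" by auto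
    then show ?thesis
      unfolding rp coeff_linear_mult[OF p ax] IH c using ax by (simp add: a_minus_def del: One_nat_def)
  qed
qed

text \<open>The degree of a monic polynomial is recorded explicitly, instead of through \<open>deg\<close>, so that the
predicate is preserved by every ring homomorphism, even one onto the zero ring.\<close>

definition monic_of_degree :: "('r, 'm) ring_scheme \<Rightarrow> nat \<Rightarrow> (nat \<Rightarrow> 'r) \<Rightarrow> bool"
  where "monic_of_degree R d p \<longleftrightarrow>
    p \<in> carrier (UP R) \<and> p d = \<one>\<^bsub>R\<^esub> \<and> (\<forall>i>d. p i = \<zero>\<^bsub>R\<^esub>)"

lemma (in UP_cring) root_poly_monic:
  assumes "finite J" "a \<in> J \<rightarrow> carrier R"
  shows "monic_of_degree R (card J) (root_poly R J a)"
  using root_poly_closed[OF assms(2)] coeff_root_poly[OF assms] R.elem_sym_0[OF assms(1)]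
  by (simp add: monic_of_degree_def P_def coeff_UP)

lemma monic_of_degree_map:
  assumes "ring_hom_cring S T h" "monic_of_degree S d p"
  shows "monic_of_degree T d (\<lambda>i. h (p i))"
proof -
  interpret ring_hom_cring S T h by fact
  show ?thesis
    using assms(2) ring_hom_closed[OF UP_map_hom[OF assms(1)]] by (auto simp: monic_of_degree_def)
qed

text \<open>The leading coefficient of \<open>p g\<close> is that of \<open>g\<close>, since \<open>p\<close> has leading coefficient \<open>1\<close>. This replaces
the degree formula for products, which fails over rings with zero divisors.\<close>

lemma (in UP_cring) monic_mult_low_degree:
  assumes p: "monic_of_degree R d p" and g: "g \<in> carrier P"
    and low: "\<And>i. i \<ge> d \<Longrightarrow> (p \<otimes>\<^bsub>P\<^esub> g) i = \<zero>"
  shows "g = \<zero>\<^bsub>P\<^esub>"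
proof (rule ccontr)
  assume "g \<noteq> \<zero>\<^bsub>P\<^esub>"
  then have g0: "coeff P g (deg R g) \<noteq> \<zero>" using lcoeff_nonzero2[OF g] by simp
  let ?e = "deg R g"
  have pP: "p \<in> carrier P" using p by (simp add: monic_of_degree_def P_def)
  have "coeff P (p \<otimes>\<^bsub>P\<^esub> g) (d + ?e) = (\<Oplus>i\<in>{..d + ?e}. coeff P p i \<otimes> coeff P g (d + ?e - i))"
    by (rule coeff_mult[OF pP g])
  also have "\<dots> = (\<Oplus>i\<in>{..d + ?e}. if d = i then coeff P g ?e else \<zero>)"
  proof (rule R.finsum_cong'[OF refl])
    fix i assume "i \<in> {..d + ?e}"
    consider "i < d" | "i = d" | "d < i" by linarith
    then show "coeff P p i \<otimes> coeff P g (d + ?e - i) = (if d = i then coeff P g ?e else \<zero>)"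
    proof cases
      case 1
      then show ?thesis using deg_aboveD[OF _ g, of "d + ?e - i"] pP by simp
    next
      case 2
      then show ?thesis using p pP g by (simp add: monic_of_degree_def UP_apply)
    next
      case 3
      then show ?thesis using p pP g by (simp add: monic_of_degree_def UP_apply(2)[OF pP])
    qed
  qed (use g in auto)
  also have "\<dots> = coeff P g ?e" using g by (intro R.finsum_singleton) auto
  finally show False using low[of "d + ?e"] g0 P.m_closed[OF pP g] by (simp add: UP_apply)
qed

lemma (in UP_cring) nonzero_poly_nontrivial:
  assumes "f \<in> carrier P" "f \<noteq> \<zero>\<^bsub>P\<^esub>"
  shows "\<one> \<noteq> \<zero>"
proof
  assume "\<one> = \<zero>"
  then have "f i = \<zero>" for i using R.one_zeroD UP_apply(1)[OF assms(1)] by auto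
  then have "f = \<zero>\<^bsub>P\<^esub>" using assms(1) by (intro up_eqI) (auto simp: UP_apply)
  then show False using assms(2) by simp
qed

text \<open>For \<open>0 < d < n\<close> the divisor \<open>p\<close> is proper, since a nonzero multiple of \<open>f\<close> has degree at least \<open>n\<close>. So
irreducibility makes \<open>p\<close> a unit; but a nonzero multiple of \<open>p\<close> has degree at least \<open>d > 0\<close> and cannot be \<open>1\<close>.\<close>

lemma (in UP_cring) irreducible_monic_factor:
  assumes irr: "ring_irreducible\<^bsub>P\<^esub> f" and f: "monic_of_degree R n f"
    and p: "monic_of_degree R d p" and q: "q \<in> carrier P" and fpq: "f = p \<otimes>\<^bsub>P\<^esub> q"
  shows "d = 0 \<or> n \<le> d"
proof (rule ccontr)
  assume "\<not> ?thesis"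
  then have d: "0 < d" "d < n" by auto
  have fP: "f \<in> carrier P" and pP: "p \<in> carrier P" using f p by (simp_all add: monic_of_degree_def P_def)
  have nz: "\<one> \<noteq> \<zero>"
    using nonzero_poly_nontrivial[OF fP] irr by (simp add: ring_irreducible_def)
  have "\<not> f divides\<^bsub>P\<^esub> p"
  proof
    assume "f divides\<^bsub>P\<^esub> p"
    then obtain g where g: "g \<in> carrier P" "p = f \<otimes>\<^bsub>P\<^esub> g" by (auto simp: factor_def)
    have "g = \<zero>\<^bsub>P\<^esub>"
      using monic_mult_low_degree[OF f g(1)] p d unfolding g(2)[symmetric] by (auto simp: monic_of_degree_def)
    then have "p = \<zero>\<^bsub>P\<^esub>" using g fP by simp
    then have "p d = \<zero>" using coeff_zero[of d] UP_apply(2)[OF P.zero_closed] by simp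
    then show False using p nz by (simp add: monic_of_degree_def)
  qed
  moreover have "p divides\<^bsub>P\<^esub> f" using q fpq by (auto simp: factor_def)
  ultimately have "p \<in> Units P"
    using irr pP by (simp add: ring_irreducible_def irreducible_def properfactor_def)
  then obtain g where g: "g \<in> carrier P" "p \<otimes>\<^bsub>P\<^esub> g = \<one>\<^bsub>P\<^esub>" by (auto simp: Units_def)
  have "(\<one>\<^bsub>P\<^esub>) i = \<zero>" if "i \<ge> d" for i
    using coeff_one[of i] that d(1) UP_apply(2)[OF P.one_closed, of i] by simp
  then have "g = \<zero>\<^bsub>P\<^esub>" using monic_mult_low_degree[OF p g(1)] unfolding g(2) by blast
  then have "\<one>\<^bsub>P\<^esub> = \<zero>\<^bsub>P\<^esub>" using g(2) pP by simp
  then have "coeff P \<one>\<^bsub>P\<^esub> 0 = coeff P \<zero>\<^bsub>P\<^esub> 0" by simp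
  then show False using nz by simp
qed

section \<open>The determinant of a companion matrix\<close>

text \<open>The cycle \<open>k \<mapsto> m \<mapsto> m - 1 \<mapsto> \<dots> \<mapsto> k\<close>. Row \<open>i\<close> of \<open>X - C\<close>, for a companion matrix \<open>C\<close> of size \<open>m + 1\<close>, has nonzero
entries only in the columns \<open>i - 1\<close>, \<open>i\<close> and \<open>m\<close>; these cycles are the only permutations that
contribute to its Leibniz expansion.\<close>

definition companion_cycle :: "nat \<Rightarrow> nat \<Rightarrow> nat \<Rightarrow> nat"
  where "companion_cycle m k i = (if i = k then m else if k < i \<and> i \<le> m then i - 1 else i)"

text \<open>Splitting off one transposition at a time shows that the cycle is a product of \<open>m - k\<close>
transpositions, which determines its sign.\<close>

lemma companion_cycle_Suc:
  assumes "k < m"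
  shows "companion_cycle m k = companion_cycle m (Suc k) \<circ> transpose k (Suc k)"
proof
  fix i
  consider "i = k" | "i = Suc k" | "i < k" | "Suc k < i" by linarith
  then show "companion_cycle m k i = (companion_cycle m (Suc k) \<circ> transpose k (Suc k)) i"
    by cases (use assms in \<open>auto simp: companion_cycle_def transpose_def\<close>)
qed

lemma companion_cycle_permutes:
  assumes "k \<le> m"
  shows "companion_cycle m k permutes {..<Suc m} \<and> (evenperm (companion_cycle m k) \<longleftrightarrow> even (m - k))"
  using assms
proof (induction k rule: inc_induct)
  case base
  have "companion_cycle m m = id" by (auto simp: companion_cycle_def fun_eq_iff)
  then show ?case by (simp only: permutes_id evenperm_id) simp
next
  case (step k)
  have t: "transpose k (Suc k) permutes {..<Suc m}"
    using step.hyps by (intro permutes_swap_id) auto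
  have "permutation (companion_cycle m (Suc k))" "permutation (transpose k (Suc k))"
    using step.IH by (auto intro: permutation_swap_id permutes_imp_permutation[OF finite_lessThan])
  then have "evenperm (companion_cycle m k) \<longleftrightarrow> \<not> even (m - Suc k)"
    using step by (simp add: companion_cycle_Suc evenperm_comp evenperm_swap)
  also have "\<dots> \<longleftrightarrow> even (m - k)" using step.hyps by (simp add: Suc_diff_Suc[symmetric])
  finally show ?case
    using permutes_compose[OF t, of "companion_cycle m (Suc k)"] step.IH
    unfolding companion_cycle_Suc[OF step.hyps(2)] by blast
qed

text \<open>Let \<open>k\<close> be the row sent to the last column. Going up from row \<open>0\<close>, each row before \<open>k\<close> must stay on the
diagonal because the column to its left is taken; going down from row \<open>m\<close>, each row after \<open>k\<close> must
move to the left because its diagonal column is taken.\<close>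

lemma permutes_eq_companion_cycle:
  assumes p: "p permutes {..<Suc m}"
    and supp: "\<And>i. i \<le> m \<Longrightarrow> p i = i \<or> Suc (p i) = i \<or> p i = m"
  shows "\<exists>k\<le>m. p = companion_cycle m k"
proof -
  have inj: "p i = p j \<longleftrightarrow> i = j" for i j using permutes_inj[OF p] by (auto simp: inj_def)
  obtain k where k: "p k = m" "k \<le> m"
    using permutes_surj[OF p] permutes_not_in[OF p]
    by (metis lessThan_iff less_Suc_eq_le surj_def order_refl)
  have low: "p i = i" if "i < k" for i
    using that
  proof (induction i rule: less_induct)
    case (less i)
    have "p i \<noteq> m" using inj[of i k] k less.prems by auto
    then consider "p i = i" | "Suc (p i) = i" using supp[of i] k less.prems by auto
    then show ?case
    proof cases
      case 2
      then have "p (p i) = p i" using less by auto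
      then show ?thesis using inj[of "p i" i] by simp
    qed
  qed
  have high: "Suc (p i) = i" if "k < i" "i \<le> m" for i
    using that(2,1)
  proof (induction i rule: inc_induct)
    case base
    then show ?case using supp[of m] inj[of m k] k by auto
  next
    case (step i)
    have "p i \<noteq> m" using inj[of i k] k step.prems by auto
    moreover have "p i \<noteq> i" using step inj[of "Suc i" i] by auto
    ultimately show ?case using supp[of i] step.hyps by auto
  qed
  have "p i = companion_cycle m k i" for i
  proof -
    consider "i < k" | "i = k" | "k < i" "i \<le> m" | "m < i" by linarith
    then show ?thesis
    proof cases
      case 4
      then show ?thesis using permutes_not_in[OF p, of i] k by (auto simp: companion_cycle_def)
    next
      case 3
      then show ?thesis using high[of i] by (auto simp: companion_cycle_def)
    qed (use low k in \<open>auto simp: companion_cycle_def\<close>)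
  qed
  then show ?thesis using k(2) by blast
qed

lemma (in cring) minus_one_pow_square: "(\<ominus> \<one>) [^] (k::nat) \<otimes> (\<ominus> \<one>) [^] k = \<one>"
proof (induction k)
  case (Suc k)
  have m: "(\<ominus> \<one>) [^] k \<in> carrier R" by simp
  have "(\<ominus> \<one>) [^] Suc k \<otimes> (\<ominus> \<one>) [^] Suc k = (\<ominus> \<one>) [^] k \<otimes> (\<ominus> \<one>) [^] k"
    using m by (simp add: r_minus l_minus)
  then show ?case using Suc by simp
qed simp

lemma (in cring) finprod_zero:
  assumes "finite J" "j \<in> J" "a j = \<zero>" "a \<in> J \<rightarrow> carrier R"
  shows "(\<Otimes>i\<in>J. a i) = \<zero>"
proof -
  have "(\<Otimes>i\<in>insert j (J - {j}). a i) = a j \<otimes> (\<Otimes>i\<in>J - {j}. a i)"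
    using assms by (intro finprod_insert) auto
  moreover have "insert j (J - {j}) = J" using assms by auto
  moreover have "(\<Otimes>i\<in>J - {j}. a i) \<in> carrier R" using assms by (intro finprod_closed) auto
  ultimately show ?thesis using assms by simp
qed

text \<open>The cycle through rows \<open>k, \<dots>, m\<close> contributes \<open>c\<^sub>k x^k\<close>: the rows before \<open>k\<close> give \<open>x^k\<close>, row \<open>k\<close> gives \<open>c\<^sub>k\<close>, and
the \<open>m - k\<close> entries \<open>-1\<close> of the later rows cancel the sign of the cycle. For \<open>k = m\<close> the entry in row
\<open>k\<close> is \<open>x + c\<^sub>m\<close>, which accounts for the leading power of \<open>x\<close>.\<close>

lemma (in cring) companion_det:
  fixes m :: nat
  assumes x: "x \<in> carrier R" and c: "c \<in> {..<Suc m} \<rightarrow> carrier R"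
    and N: "\<And>i j. i \<le> m \<Longrightarrow> j \<le> m \<Longrightarrow> N i j = (if i = j then x else \<zero>) \<ominus>
      (if j < m then (if i = Suc j then \<one> else \<zero>) else \<ominus> c i)"
  shows "ring_det R (Suc m) N = x [^] Suc m \<oplus> (\<Oplus>k\<in>{..<Suc m}. c k \<otimes> x [^] k)"
proof -
  let ?sg = "\<lambda>p. if evenperm p then \<one> else \<ominus> \<one>"
  let ?t = "\<lambda>p. ?sg p \<otimes> (\<Otimes>i\<in>{..<Suc m}. N i (p i))"
  let ?C = "companion_cycle m ` {..<Suc m}"
  have cc: "c i \<in> carrier R" if "i \<le> m" for i using c that by auto
  have Nc: "N i j \<in> carrier R" if "i \<le> m" "j \<le> m" for i j
    unfolding N[OF that] using x cc[OF that(1)] by auto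
  have tc: "?t p \<in> carrier R" if "p permutes {..<Suc m}" for p
  proof -
    have pm: "p i \<le> m" if "i \<le> m" for i using permutes_in_image[OF \<open>p permutes _\<close>, of i] that by auto
    have "(\<Otimes>i\<in>{..<Suc m}. N i (p i)) \<in> carrier R"
      by (intro finprod_closed Pi_I Nc pm) (simp_all add: less_Suc_eq_le)
    then show ?thesis by simp
  qed
  have C: "?C \<subseteq> {p. p permutes {..<Suc m}}" using companion_cycle_permutes by auto
  have "ring_det R (Suc m) N = (\<Oplus>p\<in>?C. ?t p)"
    unfolding ring_det_def
  proof (rule add.finprod_mono_neutral_cong_right)
    show "finite {p. p permutes {..<Suc m}}" by (rule finite_permutations) simp
    show "?C \<subseteq> {p. p permutes {..<Suc m}}" by (rule C)
    fix p assume p: "p \<in> {p. p permutes {..<Suc m}} - ?C"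
    show "?t p = \<zero>\<^bsub>R\<^esub>"
    proof -
      have pm: "p i \<le> m" if "i \<le> m" for i using permutes_in_image[of p "{..<Suc m}" i] that p by auto
      from p obtain i where i: "i \<le> m" "p i \<noteq> i" "Suc (p i) \<noteq> i" "p i \<noteq> m"
        using permutes_eq_companion_cycle[of p m] by fastforce
      have "N i (p i) = \<zero>" unfolding N[OF i(1) pm[OF i(1)]] using i pm[OF i(1)] by (auto simp: a_minus_def)
      then have "(\<Otimes>i\<in>{..<Suc m}. N i (p i)) = \<zero>"
        using i(1) by (intro finprod_zero[of _ i] Pi_I Nc pm) (simp_all add: less_Suc_eq_le)
      then show ?thesis by simp
    qed
  next
    show "?t \<in> {p. p permutes {..<Suc m}} \<rightarrow> carrier R" using tc by blast
  qed simp_all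
  also have "\<dots> = (\<Oplus>k\<in>{..<Suc m}. ?t (companion_cycle m k))"
  proof (rule finsum_reindex)
    show "?t \<in> ?C \<rightarrow> carrier R" using tc C by blast
    have "companion_cycle m k k = m" "companion_cycle m k l \<noteq> m" if "k \<le> m" "l \<le> m" "k \<noteq> l" for k l
      using that by (auto simp: companion_cycle_def)
    then show "inj_on (companion_cycle m) {..<Suc m}"
      by (intro inj_onI) (metis lessThan_iff less_Suc_eq_le)
  qed
  also have "\<dots> = (\<Oplus>k\<in>{..<Suc m}. x [^] k \<otimes> (if k = m then x \<oplus> c m else c k))"
  proof (rule finsum_cong'[OF refl])
    fix k assume "k \<in> {..<Suc m}"
    then have k: "k \<le> m" by auto
    let ?d = "if k = m then x \<oplus> c m else c k"
    have d: "?d \<in> carrier R" using x cc k by auto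
    let ?g = "\<lambda>i. N i (companion_cycle m k i)"
    have gl: "?g i = x" if "i < k" for i
      using that k N[of i i] x by (simp add: companion_cycle_def a_minus_def)
    have gk: "?g k = ?d"
      using k N[of k m] x cc by (auto simp: companion_cycle_def a_minus_def)
    have gh: "?g i = \<ominus> \<one>" if "k < i" "i \<le> m" for i
      using that k N[of i "i - 1"] x by (auto simp: companion_cycle_def a_minus_def)
    have "{..<Suc m} = {..<k} \<union> insert k {k<..m}" using k by auto
    then have "(\<Otimes>i\<in>{..<Suc m}. ?g i) = (\<Otimes>i\<in>{..<k} \<union> insert k {k<..m}. ?g i)" by simp
    also have "\<dots> = (\<Otimes>i\<in>{..<k}. ?g i) \<otimes> (\<Otimes>i\<in>insert k {k<..m}. ?g i)"
      using x d by (intro finprod_Un_disjoint) (auto simp: gl gk gh)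
    also have "(\<Otimes>i\<in>{..<k}. ?g i) = (\<Otimes>i\<in>{..<k}. x)" using x by (intro finprod_cong') (auto simp: gl)
    also have "\<dots> = x [^] k" using x by (simp add: finprod_const)
    also have "(\<Otimes>i\<in>insert k {k<..m}. ?g i) = ?d \<otimes> (\<Otimes>i\<in>{k<..m}. ?g i)"
      unfolding gk[symmetric] using d by (intro finprod_insert) (auto simp: gk gh)
    also have "(\<Otimes>i\<in>{k<..m}. ?g i) = (\<Otimes>i\<in>{k<..m}. \<ominus> \<one>)" by (intro finprod_cong') (auto simp: gh)
    also have "\<dots> = (\<ominus> \<one>) [^] (m - k)" by (simp add: finprod_const)
    finally have prod: "(\<Otimes>i\<in>{..<Suc m}. ?g i) = x [^] k \<otimes> (?d \<otimes> (\<ominus> \<one>) [^] (m - k))" .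
    have sgn: "(\<ominus> \<one>) [^] j = (if even j then \<one> else \<ominus> \<one>)" for j :: nat
      by (induction j) (auto simp: l_minus)
    have sg: "?sg (companion_cycle m k) = (\<ominus> \<one>) [^] (m - k)"
      using companion_cycle_permutes[OF k] by (simp add: sgn)
    have sq: "(\<ominus> \<one>) [^] (m - k) \<otimes> (\<ominus> \<one>) [^] (m - k) = \<one>"
      by (rule minus_one_pow_square)
    define s where "s = (\<ominus> \<one>) [^] (m - k)"
    have s: "s \<in> carrier R" by (simp add: s_def)
    have xk: "x [^] k \<in> carrier R" using x by simp
    have "s \<otimes> (x [^] k \<otimes> (?d \<otimes> s)) = (s \<otimes> s) \<otimes> (x [^] k \<otimes> ?d)"
      using s xk d by (simp only: m_ac m_closed)
    also have "\<dots> = x [^] k \<otimes> ?d" using sq xk d by (simp add: s_def)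
    finally show "?t (companion_cycle m k) = x [^] k \<otimes> ?d"
      unfolding prod sg s_def .
  qed (use x cc in auto)
  also have "\<dots> = x [^] m \<otimes> (x \<oplus> c m) \<oplus> (\<Oplus>k\<in>{..<m}. x [^] k \<otimes> (if k = m then x \<oplus> c m else c k))"
    unfolding lessThan_Suc using x cc by (subst finsum_insert) auto
  also have "(\<Oplus>k\<in>{..<m}. x [^] k \<otimes> (if k = m then x \<oplus> c m else c k)) = (\<Oplus>k\<in>{..<m}. c k \<otimes> x [^] k)"
    using x cc by (intro finsum_cong') (auto simp: m_comm)
  also have "x [^] m \<otimes> (x \<oplus> c m) = x [^] Suc m \<oplus> c m \<otimes> x [^] m"
    using x cc[of m] by (simp add: r_distr m_comm)
  also have "x [^] Suc m \<oplus> c m \<otimes> x [^] m \<oplus> (\<Oplus>k\<in>{..<m}. c k \<otimes> x [^] k)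
      = x [^] Suc m \<oplus> (\<Oplus>k\<in>{..<Suc m}. c k \<otimes> x [^] k)"
    unfolding lessThan_Suc using x cc
    by (subst finsum_insert) (auto intro!: a_assoc finsum_closed)
  finally show ?thesis .
qed

section \<open>The power basis of a monic quotient\<close>

locale monic_quotient = UP_cring R P for R (structure) and P (structure) +
  fixes f :: "nat \<Rightarrow> 'a" and n :: nat
  assumes nontrivial: "\<one> \<noteq> \<zero>" and monic: "monic_of_degree R n f"
begin

abbreviation "I \<equiv> PIdl\<^bsub>P\<^esub> f"
abbreviation "A \<equiv> quotient_algebra R P I"
abbreviation "cls p \<equiv> I +>\<^bsub>P\<^esub> p"

definition low_degree :: "(nat \<Rightarrow> 'a) \<Rightarrow> bool"
  where "low_degree p \<longleftrightarrow> p \<in> carrier P \<and> (\<forall>i\<ge>n. p i = \<zero>)"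

lemma f_closed: "f \<in> carrier P"
  using monic by (simp add: monic_of_degree_def P_def)

sublocale I: ideal I P
  by (rule P.cgenideal_ideal[OF f_closed])

sublocale A: cring A
  by (rule quotient_algebra_cring[OF P.is_cring I.is_ideal])

sublocale proj: ring_hom_cring P A "\<lambda>p. cls p"
  by unfold_locales (rule quotient_algebra_proj[OF I.is_ideal])

lemma carrier_A: "carrier A = (\<lambda>p. cls p) ` carrier P"
  by (rule quotient_algebra_carrier)

text \<open>The defining union over the representatives of a class collapses to a single coset, because \<open>I\<close> is stable
under multiplication by constants.\<close>

lemma smult_cls:
  assumes r: "r \<in> carrier R" and p: "p \<in> carrier P"
  shows "r \<odot>\<^bsub>A\<^esub> cls p = cls (r \<odot>\<^bsub>P\<^esub> p)"
proof -
  have "cls (r \<odot>\<^bsub>P\<^esub> x) = cls (r \<odot>\<^bsub>P\<^esub> p)" if x: "x \<in> cls p" for x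
  proof -
    have xc: "x \<in> carrier P" using x p I.a_subset P.a_r_coset_subset_G by blast
    have "cls x = cls p" using P.a_repr_independence[OF x p I.a_subgroup] by simp
    then have "x \<ominus>\<^bsub>P\<^esub> p \<in> I" using I.rcos_eq_iff[OF xc p] by simp
    then have "monom P r 0 \<otimes>\<^bsub>P\<^esub> (x \<ominus>\<^bsub>P\<^esub> p) \<in> I" using r by (intro I.I_l_closed) auto
    moreover have "monom P r 0 \<otimes>\<^bsub>P\<^esub> (x \<ominus>\<^bsub>P\<^esub> p) = r \<odot>\<^bsub>P\<^esub> x \<ominus>\<^bsub>P\<^esub> r \<odot>\<^bsub>P\<^esub> p"
      using r xc p by (simp add: a_minus_def P.r_distr P.r_minus monom_mult_is_smult)
    ultimately show ?thesis using I.rcos_eq_iff[of "r \<odot>\<^bsub>P\<^esub> x" "r \<odot>\<^bsub>P\<^esub> p"] r xc p by simp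
  qed
  moreover have "p \<in> cls p" by (rule I.a_rcos_self[OF p])
  ultimately have "(\<Union>x\<in>cls p. cls (r \<odot>\<^bsub>P\<^esub> x)) = cls (r \<odot>\<^bsub>P\<^esub> p)" by blast
  then show ?thesis by (simp add: quotient_algebra_def)
qed

lemma smult_closed_quotient:
  "r \<in> carrier R \<Longrightarrow> x \<in> carrier A \<Longrightarrow> r \<odot>\<^bsub>A\<^esub> x \<in> carrier A"
  unfolding carrier_A using smult_cls by auto

text \<open>The difference is a multiple of \<open>f\<close> of degree less than \<open>n\<close>, hence zero.\<close>

lemma low_degree_unique:
  assumes p: "low_degree p" and q: "low_degree q" and eq: "cls p = cls q"
  shows "p = q"
proof -
  have pc: "p \<in> carrier P" and qc: "q \<in> carrier P" using p q by (auto simp: low_degree_def)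
  have "p \<ominus>\<^bsub>P\<^esub> q \<in> I" using eq I.rcos_eq_iff[OF pc qc] by simp
  then obtain g where g: "g \<in> carrier P" "p \<ominus>\<^bsub>P\<^esub> q = g \<otimes>\<^bsub>P\<^esub> f"
    unfolding cgenideal_def by blast
  have "(p \<ominus>\<^bsub>P\<^esub> q) i = \<zero>" if "i \<ge> n" for i
    using coeff_minus[OF pc qc, of i] UP_apply(2)[OF P.minus_closed[OF pc qc], of i] p q that
    by (simp add: low_degree_def UP_apply(2) a_minus_def)
  then have "(f \<otimes>\<^bsub>P\<^esub> g) i = \<zero>" if "i \<ge> n" for i
    using that g P.m_comm[OF g(1) f_closed] by simp
  then have "g = \<zero>\<^bsub>P\<^esub>" by (rule monic_mult_low_degree[OF monic g(1)])
  then have "p \<ominus>\<^bsub>P\<^esub> q = \<zero>\<^bsub>P\<^esub>" using g f_closed by simp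
  then show ?thesis using pc qc by (simp add: P.r_right_minus_eq)
qed

lemma low_degree_exists:
  assumes p: "p \<in> carrier P"
  shows "\<exists>r. low_degree r \<and> cls p = cls r"
proof -
  have fc: "coeff P f i = \<zero>" if "n < i" for i
    using monic that by (simp_all add: monic_of_degree_def UP_apply(2)[OF f_closed])
  have fn: "coeff P f n = \<one>" using monic by (simp add: monic_of_degree_def UP_apply(2)[OF f_closed])
  have deg: "deg R f = n"
  proof (rule antisym)
    show "deg R f \<le> n" by (rule deg_aboveI[OF fc f_closed])
    show "n \<le> deg R f" using fn nontrivial by (intro deg_belowI f_closed) auto
  qed
  have f0: "f \<noteq> \<zero>\<^bsub>P\<^esub>" using fn nontrivial by auto
  obtain q r k where q: "q \<in> carrier P" and r: "r \<in> carrier P"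
    and eq: "coeff P f (deg R f) [^] (k::nat) \<odot>\<^bsub>P\<^esub> p = f \<otimes>\<^bsub>P\<^esub> q \<oplus>\<^bsub>P\<^esub> r"
    and rd: "r = \<zero>\<^bsub>P\<^esub> \<or> deg R r < deg R f"
    using long_div_theorem[OF f_closed p f0] by blast
  have eq: "p = f \<otimes>\<^bsub>P\<^esub> q \<oplus>\<^bsub>P\<^esub> r" using eq p by (simp add: deg fn)
  have "p \<ominus>\<^bsub>P\<^esub> r = q \<otimes>\<^bsub>P\<^esub> f"
    unfolding eq using q r f_closed by algebra
  then have "p \<ominus>\<^bsub>P\<^esub> r \<in> I" using q unfolding cgenideal_def by blast
  then have "cls p = cls r" using I.rcos_eq_iff[OF p r] by simp
  moreover have "low_degree r"
  proof -
    have "r i = \<zero>" if "i \<ge> n" for i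
      using rd
    proof
      assume "r = \<zero>\<^bsub>P\<^esub>" then show ?thesis using coeff_zero[of i] UP_apply(2)[OF r, of i] by simp
    next
      assume "deg R r < deg R f"
      then show ?thesis using deg_aboveD[OF _ r, of i] that UP_apply(2)[OF r, of i] by (simp add: deg)
    qed
    then show ?thesis using r by (simp add: low_degree_def)
  qed
  ultimately show ?thesis by blast
qed

definition power_basis :: "nat \<Rightarrow> (nat \<Rightarrow> 'a) set"
  where "power_basis i = cls (monom P \<one> i)"

definition trunc :: "(nat \<Rightarrow> 'a) \<Rightarrow> nat \<Rightarrow> 'a"
  where "trunc c = (\<lambda>i. if i < n then c i else \<zero>)"

lemma trunc_low: "c \<in> {..<n} \<rightarrow> carrier R \<Longrightarrow> low_degree (trunc c)"
  unfolding low_degree_def trunc_def P_def carrier_UP_iff by (auto simp: Pi_def intro: exI[of _ n])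

lemma power_basis_sum:
  assumes c: "c \<in> {..<n} \<rightarrow> carrier R"
  shows "(\<Oplus>\<^bsub>A\<^esub>i\<in>{..<n}. c i \<odot>\<^bsub>A\<^esub> power_basis i) = cls (trunc c)"
proof -
  have cc: "c i \<in> carrier R" if "i < n" for i using c that by auto
  have m: "(\<lambda>i. monom P (c i) i) \<in> {..<n} \<rightarrow> carrier P" using c by (auto intro!: monom_closed)
  have "(\<Oplus>\<^bsub>A\<^esub>i\<in>{..<n}. c i \<odot>\<^bsub>A\<^esub> power_basis i) = (\<Oplus>\<^bsub>A\<^esub>i\<in>{..<n}. cls (monom P (c i) i))"
  proof (rule A.finsum_cong'[OF refl])
    fix i assume "i \<in> {..<n}"
    then have ci: "c i \<in> carrier R" using c by auto
    then show "c i \<odot>\<^bsub>A\<^esub> power_basis i = cls (monom P (c i) i)"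
      unfolding power_basis_def using smult_cls[OF ci, of "monom P \<one> i"] monom_mult_smult[OF ci R.one_closed, of i]
      by simp
  qed (use m in auto)
  also have "\<dots> = cls (\<Oplus>\<^bsub>P\<^esub>i\<in>{..<n}. monom P (c i) i)"
    using proj.hom_finsum[OF m] by (simp add: o_def)
  also have "(\<Oplus>\<^bsub>P\<^esub>i\<in>{..<n}. monom P (c i) i) = trunc c"
  proof (rule up_eqI)
    show t: "trunc c \<in> carrier P" using trunc_low[OF c] by (simp add: low_degree_def)
    show "(\<Oplus>\<^bsub>P\<^esub>i\<in>{..<n}. monom P (c i) i) \<in> carrier P" using m by (rule P.finsum_closed)
    fix k
    have "coeff P (\<Oplus>\<^bsub>P\<^esub>i\<in>{..<n}. monom P (c i) i) k = (\<Oplus>i\<in>{..<n}. coeff P (monom P (c i) i) k)"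
      using m by (intro coeff_finsum) auto
    also have "\<dots> = (\<Oplus>i\<in>{..<n}. if k = i then c i else \<zero>)"
      by (intro R.finsum_cong') (auto simp: coeff_monom[OF cc] cc)
    also have "\<dots> = trunc c k"
    proof (cases "k < n")
      case True
      then show ?thesis by (subst R.finsum_singleton) (auto simp: trunc_def cc)
    next
      case False
      have "(\<Oplus>i\<in>{..<n}. if k = i then c i else \<zero>) = (\<Oplus>i\<in>{..<n}. \<zero>)"
        using False by (intro R.finsum_cong') auto
      then show ?thesis using False by (simp add: trunc_def)
    qed
    finally show "coeff P (\<Oplus>\<^bsub>P\<^esub>i\<in>{..<n}. monom P (c i) i) k = coeff P (trunc c) k"
      using UP_apply(2)[OF t] by simp
  qed
  finally show ?thesis .
qed

text \<open>The coordinates of a class in the power basis are the coefficients of its representative of degree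
less than \<open>n\<close>.\<close>

lemma power_basis_coords:
  assumes r: "low_degree r"
  shows "c \<in> {..<n} \<rightarrow>\<^sub>E carrier R \<and> cls r = (\<Oplus>\<^bsub>A\<^esub>i\<in>{..<n}. c i \<odot>\<^bsub>A\<^esub> power_basis i)
    \<longleftrightarrow> c = restrict r {..<n}"
proof
  assume c: "c \<in> {..<n} \<rightarrow>\<^sub>E carrier R \<and> cls r = (\<Oplus>\<^bsub>A\<^esub>i\<in>{..<n}. c i \<odot>\<^bsub>A\<^esub> power_basis i)"
  then have cR: "c \<in> {..<n} \<rightarrow> carrier R" by auto
  have "r = trunc c"
    using low_degree_unique[OF r trunc_low[OF cR]] c power_basis_sum[OF cR] by simp
  then show "c = restrict r {..<n}" using c by (auto simp: trunc_def fun_eq_iff PiE_iff extensional_def)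
next
  assume c: "c = restrict r {..<n}"
  have rc: "r \<in> carrier P" using r by (simp add: low_degree_def)
  then have cR: "c \<in> {..<n} \<rightarrow> carrier R" using UP_apply(1) by (auto simp: c)
  have "trunc c = r" using r by (auto simp: trunc_def c low_degree_def fun_eq_iff)
  then show "c \<in> {..<n} \<rightarrow>\<^sub>E carrier R \<and> cls r = (\<Oplus>\<^bsub>A\<^esub>i\<in>{..<n}. c i \<odot>\<^bsub>A\<^esub> power_basis i)"
    using power_basis_sum[OF cR] UP_apply(1)[OF rc] by (auto simp: c)
qed

lemma module_basis_power_basis: "module_basis R A n power_basis"
  unfolding module_basis_def
proof (intro conjI ballI)
  show "power_basis \<in> {..<n} \<rightarrow> carrier A"
    by (auto simp: power_basis_def)
  fix x assume "x \<in> carrier A"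
  then obtain r where r: "low_degree r" "x = cls r"
    unfolding carrier_A using low_degree_exists by blast
  show "\<exists>!c. c \<in> {..<n} \<rightarrow>\<^sub>E carrier R \<and> x = (\<Oplus>\<^bsub>A\<^esub>i\<in>{..<n}. c i \<odot>\<^bsub>A\<^esub> power_basis i)"
    unfolding r(2) power_basis_coords[OF r(1)] by simp
qed

lemma coords_power_basis:
  assumes r: "low_degree r" and i: "i < n"
  shows "coords R A n power_basis (cls r) i = r i"
  unfolding coords_def power_basis_coords[OF r] using i by simp

abbreviation "\<alpha> \<equiv> cls (monom P \<one> 1)"

text \<open>The columns of the companion matrix. Multiplication by \<open>\<alpha>\<close> moves each basis vector to the next one,
except for the last, where \<open>\<alpha>^n\<close> is represented by \<open>X^n - f\<close>.\<close>

lemma mult_matrix_power_basis: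
  assumes ij: "i < n" "j < n"
  shows "mult_matrix R A n power_basis \<alpha> i j =
    (if Suc j < n then (if i = Suc j then \<one> else \<zero>) else \<ominus> f i)"
proof -
  have prod: "\<alpha> \<otimes>\<^bsub>A\<^esub> power_basis j = cls (monom P \<one> (Suc j))"
    unfolding power_basis_def plus_1_eq_Suc[symmetric] monom_one_mult[of 1 j]
    by (intro proj.hom_mult[symmetric] monom_closed R.one_closed)
  have mc: "monom P \<one> k i = (if k = i then \<one> else \<zero>)" for k i
    using coeff_monom[of \<one> k i] UP_apply(2)[of "monom P \<one> k" i] by simp
  show ?thesis
  proof (cases "Suc j < n")
    case True
    then have "low_degree (monom P \<one> (Suc j))" by (auto simp: low_degree_def mc)
    from coords_power_basis[OF this ij(1)] show ?thesis
      unfolding mult_matrix_def prod using True by (simp add: mc)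
  next
    case False
    then have n: "Suc j = n" using ij by simp
    \<comment> \<open>The representative of \<open>\<alpha>^n\<close> of degree less than \<open>n\<close>.\<close>
    define r where "r = monom P \<one> n \<ominus>\<^bsub>P\<^esub> f"
    have rP: "r \<in> carrier P" unfolding r_def using f_closed by (intro P.minus_closed) auto
    have rk: "r k = (if n = k then \<one> else \<zero>) \<ominus> f k" for k
      using coeff_minus[OF _ f_closed, of "monom P \<one> n" k] UP_apply(2)[OF rP, of k] UP_apply(2)[OF f_closed, of k]
      unfolding r_def by simp
    have "low_degree r"
      unfolding low_degree_def
    proof (intro conjI rP allI impI)
      fix k assume "n \<le> k"
      then show "r k = \<zero>" using monic by (auto simp: rk monic_of_degree_def a_minus_def R.r_neg)
    qed
    moreover have "cls (monom P \<one> n) = cls r"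
    proof -
      have "monom P \<one> n \<ominus>\<^bsub>P\<^esub> r = f"
        unfolding r_def using f_closed monom_closed[OF R.one_closed, of n] by algebra
      then show ?thesis
        using I.rcos_eq_iff[of "monom P \<one> n" r] rP P.cgenideal_self[OF f_closed] by simp
    qed
    ultimately show ?thesis
      unfolding mult_matrix_def prod n using coords_power_basis[of r i] ij False UP_apply(1)[OF f_closed, of i]
      by (simp add: rk a_minus_def)
  qed
qed

lemma char_poly_root:
  assumes n: "n > 0"
  shows "mult_char_poly R A n power_basis \<alpha> = f"
proof -
  obtain m where m: "n = Suc m" using n by (cases n) auto
  let ?X = "monom P \<one> 1"
  have fi: "f i \<in> carrier R" for i by (rule UP_apply(1)[OF f_closed])
  have pow: "?X [^]\<^bsub>P\<^esub> k = monom P \<one> k" for k :: nat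
    using monom_pow[OF R.one_closed, of 1 k] by simp
  have "mult_char_poly R A n power_basis \<alpha>
      = ring_det P n (\<lambda>i j. (if i = j then ?X else \<zero>\<^bsub>P\<^esub>) \<ominus>\<^bsub>P\<^esub> monom P (mult_matrix R A n power_basis \<alpha> i j) 0)"
    unfolding mult_char_poly_def P_def[symmetric] ..
  also have "\<dots> = ?X [^]\<^bsub>P\<^esub> Suc m \<oplus>\<^bsub>P\<^esub> (\<Oplus>\<^bsub>P\<^esub>k\<in>{..<Suc m}. monom P (f k) 0 \<otimes>\<^bsub>P\<^esub> ?X [^]\<^bsub>P\<^esub> k)"
    unfolding m
  proof (rule P.companion_det)
    fix i j assume ij: "i \<le> m" "j \<le> m"
    have "mult_matrix R A (Suc m) power_basis \<alpha> i j = (if j < m then (if i = Suc j then \<one> else \<zero>) else \<ominus> f i)"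
      using mult_matrix_power_basis[of i j] ij unfolding m less_Suc_eq_le Suc_le_eq by blast
    then    have "monom P (mult_matrix R A (Suc m) power_basis \<alpha> i j) 0
        = (if j < m then (if i = Suc j then \<one>\<^bsub>P\<^esub> else \<zero>\<^bsub>P\<^esub>) else \<ominus>\<^bsub>P\<^esub> monom P (f i) 0)"
      using fi[of i] by (simp only: if_distrib[of "\<lambda>x. monom P x 0"] monom_one monom_zero monom_a_inv)
    then show "(if i = j then ?X else \<zero>\<^bsub>P\<^esub>) \<ominus>\<^bsub>P\<^esub> monom P (mult_matrix R A (Suc m) power_basis \<alpha> i j) 0
      = (if i = j then ?X else \<zero>\<^bsub>P\<^esub>) \<ominus>\<^bsub>P\<^esub> (if j < m then (if i = Suc j then \<one>\<^bsub>P\<^esub> else \<zero>\<^bsub>P\<^esub>) else \<ominus>\<^bsub>P\<^esub> monom P (f i) 0)"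
      by (simp only:)
  qed (use fi in auto)
  also have "\<dots> = monom P \<one> n \<oplus>\<^bsub>P\<^esub> (\<Oplus>\<^bsub>P\<^esub>k\<in>{..<n}. monom P (f k) k)"
    unfolding pow m using fi
    by (intro arg_cong2[where f = "(\<oplus>\<^bsub>P\<^esub>)"] P.finsum_cong' refl)
      (auto simp: monom_mult_is_smult monom_mult_smult[symmetric])
  also have "\<dots> = f"
  proof (rule up_eqI)
    show "f \<in> carrier P" by (rule f_closed)
    show "monom P \<one> n \<oplus>\<^bsub>P\<^esub> (\<Oplus>\<^bsub>P\<^esub>k\<in>{..<n}. monom P (f k) k) \<in> carrier P"
      using fi by (intro P.a_closed P.finsum_closed) auto
    fix k
    have "coeff P (\<Oplus>\<^bsub>P\<^esub>i\<in>{..<n}. monom P (f i) i) k = (\<Oplus>i\<in>{..<n}. if k = i then f i else \<zero>)"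
      using fi by (subst coeff_finsum) (auto intro!: R.finsum_cong')
    also have "\<dots> = (if k < n then f k else \<zero>)"
    proof (cases "k < n")
      case True
      then show ?thesis using fi by (subst R.finsum_singleton) auto
    next
      case False
      have "(\<Oplus>i\<in>{..<n}. if k = i then f i else \<zero>) = (\<Oplus>i\<in>{..<n}. \<zero>)"
        using False by (intro R.finsum_cong') auto
      then show ?thesis using False by simp
    qed
    finally show "coeff P (monom P \<one> n \<oplus>\<^bsub>P\<^esub> (\<Oplus>\<^bsub>P\<^esub>k\<in>{..<n}. monom P (f k) k)) k = coeff P f k"
      using fi monic by (subst coeff_add) (auto simp: UP_apply(2)[OF f_closed] monic_of_degree_def not_less le_less
        intro!: P.finsum_closed)
  qed
  finally show ?thesis .
qed

end

section \<open>Factoring the polynomial along an orbit\<close>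

context algebra_tensor_power
begin

text \<open>\<open>\<sigma>\<close> replaces the root \<open>x^(i)\<close> by \<open>x^(\<sigma> i)\<close>, and \<open>\<sigma> ` J = J\<close>; so applying \<open>\<sigma>\<close> to all coefficients only reorders
the linear factors.\<close>

lemma invariant_root_poly:
  assumes G: "\<And>\<sigma>. \<sigma> \<in> G \<Longrightarrow> \<sigma> permutes {1..n}" and J: "\<And>\<sigma>. \<sigma> \<in> G \<Longrightarrow> \<sigma> ` J = J"
    and x: "x \<in> carrier A"
  shows "root_poly T J (\<lambda>i. tensor_embed R A n i x) \<in> carrier (UP (tensor_invariants R A n G))"
proof -
  interpret PT: UP_cring T "UP T" by unfold_locales simp
  let ?e = "\<lambda>i. tensor_embed R A n i x"
  have e: "?e \<in> K \<rightarrow> carrier T" for K using embed_closed[OF x] by blast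
  have "tensor_perm \<sigma> (root_poly T J ?e i) = root_poly T J ?e i" if s: "\<sigma> \<in> G" for \<sigma> i
  proof -
    note p = G[OF s]
    have h: "ring_hom_cring T T (tensor_perm \<sigma>)"
      by unfold_locales (rule tensor_perm_hom[OF p])
    have "(\<lambda>i. tensor_perm \<sigma> (root_poly T J ?e i)) = root_poly T J (\<lambda>j. ?e (\<sigma> j))"
      unfolding root_poly_map[OF h e] tensor_perm_embed[OF p x] ..
    also have "\<dots> = root_poly T (\<sigma> ` J) ?e"
      using permutes_inj[OF p] by (intro PT.root_poly_reindex[symmetric] e) (rule inj_on_subset, auto)
    finally show ?thesis unfolding J[OF s] by (rule fun_cong)
  qed
  moreover have "\<one>\<^bsub>tensor_invariants R A n G\<^esub> = \<one>\<^bsub>T\<^esub>" "\<zero>\<^bsub>tensor_invariants R A n G\<^esub> = \<zero>\<^bsub>T\<^esub>"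
    by (simp_all add: tensor_invariants_def)
  ultimately show ?thesis
    using PT.root_poly_closed[OF e, of J] unfolding carrier_UP_iff invariants_carrier by simp
qed

text \<open>The polynomial \<open>f\<close> plays the role of the characteristic polynomial of \<open>x\<close>, and the last hypothesis says that \<open>\<phi>\<close>
maps \<open>e\<^sub>k(x)\<close> to \<open>s\<^sub>k(x)\<close>. The factorization is the image under \<open>\<phi>\<close> of splitting
\<open>\<Prod>i\<in>{1..n}. (X - x^(i))\<close> into the parts over \<open>J\<close> and over its complement.\<close>

lemma closure_datum_factorization:
  assumes G: "\<And>\<sigma>. \<sigma> \<in> G \<Longrightarrow> \<sigma> permutes {1..n}" and J: "\<And>\<sigma>. \<sigma> \<in> G \<Longrightarrow> \<sigma> ` J = J" "J \<subseteq> {1..n}"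
    and x: "x \<in> carrier A" and \<phi>: "\<phi> \<in> ring_hom (tensor_invariants R A n G) R"
    and f: "monic_of_degree R n f"
    and \<phi>_e: "\<And>k. k \<in> {1..n} \<Longrightarrow> \<phi> (tensor_elem_sym R A n k x) = (\<ominus>\<^bsub>R\<^esub> \<one>\<^bsub>R\<^esub>) [^]\<^bsub>R\<^esub> k \<otimes>\<^bsub>R\<^esub> f (n - k)"
  shows "\<exists>p q. monic_of_degree R (card J) p \<and> q \<in> carrier (UP R) \<and> f = p \<otimes>\<^bsub>UP R\<^esub> q"
proof -
  let ?S = "tensor_invariants R A n G"
  interpret S: cring ?S by (rule invariants_cring[OF G])
  have h\<phi>: "ring_hom_cring ?S R \<phi>" by unfold_locales (rule \<phi>)
  have hid: "ring_hom_cring ?S T id" by unfold_locales (rule invariants_incl)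
  interpret h\<phi>: ring_hom_cring ?S R \<phi> by (rule h\<phi>)
  interpret hid: ring_hom_cring ?S T id by (rule hid)
  interpret PT: UP_cring T "UP T" by unfold_locales simp
  interpret PS: UP_cring ?S "UP ?S" by unfold_locales simp
  interpret PR: UP_cring R "UP R" by unfold_locales simp
  have S: "\<one>\<^bsub>?S\<^esub> = \<one>\<^bsub>T\<^esub>" "\<zero>\<^bsub>?S\<^esub> = \<zero>\<^bsub>T\<^esub>" "mult ?S = mult T" by (simp_all add: tensor_invariants_def)
  let ?e = "\<lambda>i. tensor_embed R A n i x"
  have e: "?e \<in> K \<rightarrow> carrier T" for K using embed_closed[OF x] by blast
  let ?L = "{1..n} - J"
  have L: "\<sigma> ` ?L = ?L" if "\<sigma> \<in> G" for \<sigma>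
    using permutes_image[OF G[OF that]] permutes_inj[OF G[OF that]] J(1)[OF that] by (simp add: image_set_diff)
  have all: "\<sigma> ` {1..n} = {1..n}" if "\<sigma> \<in> G" for \<sigma>
    by (rule permutes_image[OF G[OF that]])
  define p where "p K = root_poly T K ?e" for K
  have pS: "p J \<in> carrier (UP ?S)" "p ?L \<in> carrier (UP ?S)" "p {1..n} \<in> carrier (UP ?S)"
    unfolding p_def by (intro invariant_root_poly G J(1) L all x; assumption)+
  have finJ: "finite J" using J(2) by (rule finite_subset) simp
  have un: "J \<union> ?L = {1..n}" using J(2) by auto
  have mono: "monic_of_degree ?S (card K) (p K)" if "finite K" "p K \<in> carrier (UP ?S)" for K
    using PT.root_poly_monic[OF that(1) e] that(2) unfolding monic_of_degree_def p_def S by simp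
  \<comment> \<open>The products are formed over the tensor power; the inclusion of the invariants carries the
    identity back to the ring on which \<open>\<phi>\<close> is defined.\<close>
  have prod: "p {1..n} = p J \<otimes>\<^bsub>UP ?S\<^esub> p ?L"
  proof -
    have "p {1..n} = p J \<otimes>\<^bsub>UP T\<^esub> p ?L"
      using PT.root_poly_union[OF finJ _ _ e, of ?L] unfolding un p_def by simp
    also have "\<dots> = p J \<otimes>\<^bsub>UP ?S\<^esub> p ?L"
      using ring_hom_mult[OF UP_map_hom[OF hid] pS(1,2)] by simp
    finally show ?thesis .
  qed
  let ?m = "\<lambda>K i. \<phi> (p K i)"
  have "?m {1..n} i = f i" for i
  proof -
    consider "i < n" | "i = n" | "i > n" by linarith
    then show ?thesis
    proof cases
      case 1
      let ?k = "n - i"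
      let ?E = "tensor_elem_sym R A n ?k x"
      define s where "s = (\<ominus>\<^bsub>?S\<^esub> \<one>\<^bsub>?S\<^esub>) [^]\<^bsub>?S\<^esub> ?k"
      have s: "s \<in> carrier ?S" by (simp add: s_def)
      have sT: "s = (\<ominus>\<^bsub>T\<^esub> \<one>\<^bsub>T\<^esub>) [^]\<^bsub>T\<^esub> ?k"
        using hid.hom_pow[of "\<ominus>\<^bsub>?S\<^esub> \<one>\<^bsub>?S\<^esub>" ?k] hid.hom_a_inv[of "\<one>\<^bsub>?S\<^esub>"] hid.hom_one by (simp add: s_def)
      have Ee: "?E = elem_sym T ?k {1..n} ?e" by (simp add: tensor_elem_sym_def elem_sym_def)
      have E: "?E \<in> carrier T" unfolding Ee by (rule T.elem_sym_closed[OF e])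
      have pi: "p {1..n} i = s \<otimes>\<^bsub>T\<^esub> ?E"
        using PT.coeff_root_poly[OF _ e, of "{1..n}" i] 1 PT.UP_apply(2)[OF PT.root_poly_closed[OF e]]
        by (simp add: p_def sT Ee)
      have sc: "s \<in> carrier T" "s \<otimes>\<^bsub>T\<^esub> s = \<one>\<^bsub>T\<^esub>"
        using T.minus_one_pow_square[of ?k] by (simp_all add: sT)
      \<comment> \<open>As \<open>s\<close> squares to \<open>1\<close>, the elementary symmetric polynomial is a multiple of an invariant
        coefficient; so it lies in the domain of \<open>\<phi>\<close>.\<close>
      have "s \<otimes>\<^bsub>T\<^esub> p {1..n} i = ?E"
        unfolding pi using sc E by (simp flip: T.m_assoc)
      then have ES: "?E \<in> carrier ?S"
        using S.m_closed[OF s PS.UP_apply(1)[OF pS(3), of i]] by (simp add: S)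
      have "\<phi> (p {1..n} i) = \<phi> s \<otimes>\<^bsub>R\<^esub> \<phi> ?E"
        using h\<phi>.hom_mult[OF s ES] unfolding pi S(3) .
      also have "\<phi> s = (\<ominus>\<^bsub>R\<^esub> \<one>\<^bsub>R\<^esub>) [^]\<^bsub>R\<^esub> ?k"
        by (simp add: s_def)
      also have "\<phi> ?E = (\<ominus>\<^bsub>R\<^esub> \<one>\<^bsub>R\<^esub>) [^]\<^bsub>R\<^esub> ?k \<otimes>\<^bsub>R\<^esub> f i"
        using \<phi>_e[of ?k] 1 by simp
      finally show ?thesis
        using R.minus_one_pow_square[of ?k] PR.UP_apply(1)[of f i] f
        by (simp add: monic_of_degree_def flip: R.m_assoc)
    next
      case 2
      then show ?thesis using mono[OF _ pS(3)] f h\<phi>.hom_one by (simp add: monic_of_degree_def)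
    next
      case 3
      then show ?thesis using mono[OF _ pS(3)] f h\<phi>.hom_zero by (simp add: monic_of_degree_def)
    qed
  qed
  then have "f = (\<lambda>i. \<phi> (p {1..n} i))" by auto
  also have "\<dots> = ?m J \<otimes>\<^bsub>UP R\<^esub> ?m ?L"
    unfolding prod by (rule ring_hom_mult[OF UP_map_hom[OF h\<phi>] pS(1,2)])
  finally have "f = ?m J \<otimes>\<^bsub>UP R\<^esub> ?m ?L" .
  moreover have "monic_of_degree R (card J) (?m J)"
    by (rule monic_of_degree_map[OF h\<phi> mono[OF finJ pS(1)]])
  moreover have "?m ?L \<in> carrier (UP R)"
    by (rule ring_hom_closed[OF UP_map_hom[OF h\<phi>] pS(2)])
  ultimately show ?thesis by blast
qed

end

theorem corollary7p5:
  fixes R :: "('r, 'm) ring_scheme" and f :: "nat \<Rightarrow> 'r" and n :: nat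
  assumes "cring R"
    and "f \<in> carrier (UP R)"
    and "deg R f = n"
    and "coeff (UP R) f n = \<one>\<^bsub>R\<^esub>"
    and "ring_irreducible\<^bsub>UP R\<^esub> f"
  shows "\<forall>G. subgroup G (sym_group n) \<and>
             (\<exists>\<phi>. G_closure_datum R (quotient_algebra R (UP R) (PIdl\<^bsub>UP R\<^esub> f)) n G \<phi>) \<longrightarrow>
             (\<forall>i\<in>{1..n}. \<forall>j\<in>{1..n}. \<exists>\<sigma>\<in>G. \<sigma> i = j)"
proof (intro allI impI ballI)
  fix G i j
  let ?A = "quotient_algebra R (UP R) (PIdl\<^bsub>UP R\<^esub> f)"
  assume asm: "subgroup G (sym_group n) \<and> (\<exists>\<phi>. G_closure_datum R ?A n G \<phi>)"
    and i: "i \<in> {1..n}" and j: "j \<in> {1..n}"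
  interpret P: UP_cring R "UP R" using assms(1) by (simp add: UP_cring_def)
  have f_coeff: "coeff (UP R) f k = f k" for k by (rule P.UP_apply(2)[OF assms(2)])
  have monic: "monic_of_degree R n f"
    using assms(2,4) P.deg_aboveD[OF _ assms(2)] assms(3) by (auto simp: monic_of_degree_def f_coeff)
  have nontrivial: "\<one>\<^bsub>R\<^esub> \<noteq> \<zero>\<^bsub>R\<^esub>"
    using P.nonzero_poly_nontrivial[OF assms(2)] assms(5) by (simp add: ring_irreducible_def)
  interpret Q: monic_quotient R "UP R" f n
    by (intro monic_quotient.intro P.UP_cring_axioms monic_quotient_axioms.intro nontrivial monic)
  interpret algebra_tensor_power R ?A n
    by (intro algebra_tensor_power.intro algebra_tensor_power_axioms.intro assms(1) Q.A.is_cring Q.smult_closed_quotient)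
  let ?\<alpha> = "PIdl\<^bsub>UP R\<^esub> f +>\<^bsub>UP R\<^esub> monom (UP R) \<one>\<^bsub>R\<^esub> 1"
  obtain \<phi> where d: "G_closure_datum R ?A n G \<phi>" using asm by blast
  have sub: "subgroup G (sym_group n)" using asm by blast
  have G: "\<sigma> permutes {1..n}" if "\<sigma> \<in> G" for \<sigma>
    using subgroup.subset[OF sub] that by (auto simp: sym_group_def)
  \<comment> \<open>The orbit of \<open>i\<close>; it will turn out to be all of \<open>{1..n}\<close>.\<close>
  define J where "J = (\<lambda>\<sigma>. \<sigma> i) ` G"
  have J: "J \<subseteq> {1..n}" unfolding J_def using permutes_in_image[OF G] i by blast
  have finJ: "finite J" using J by (rule finite_subset) simp
  have stable: "\<sigma> ` J = J" if s: "\<sigma> \<in> G" for \<sigma>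
  proof (rule card_subset_eq[OF finJ])
    show "\<sigma> ` J \<subseteq> J"
    proof -
      have "\<sigma> (\<tau> i) \<in> J" if "\<tau> \<in> G" for \<tau>
        using subgroup.m_closed[OF sub s that] unfolding J_def sym_group_mult by (auto intro!: image_eqI[of _ _ "\<sigma> \<circ> \<tau>"])
      then show ?thesis unfolding J_def by blast
    qed
    show "card (\<sigma> ` J) = card J"
      by (rule card_image[OF inj_on_subset[OF permutes_inj[OF G[OF s]] subset_UNIV]])
  qed
  have \<alpha>: "?\<alpha> \<in> carrier ?A" by simp
  have n: "n > 0" using i by auto
  have "\<exists>p q. monic_of_degree R (card J) p \<and> q \<in> carrier (UP R) \<and> f = p \<otimes>\<^bsub>UP R\<^esub> q"
  proof (rule closure_datum_factorization[OF G stable J \<alpha> _ monic])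
    show "\<phi> \<in> ring_hom (tensor_invariants R ?A n G) R" using d by (simp add: G_closure_datum_def)
    fix k assume k: "k \<in> {1..n}"
    have "\<phi> (tensor_elem_sym R ?A n k ?\<alpha>) = char_coeff R ?A n Q.power_basis ?\<alpha> k"
      using d Q.module_basis_power_basis \<alpha> k unfolding G_closure_datum_def by blast
    then show "\<phi> (tensor_elem_sym R ?A n k ?\<alpha>) = (\<ominus>\<^bsub>R\<^esub> \<one>\<^bsub>R\<^esub>) [^]\<^bsub>R\<^esub> k \<otimes>\<^bsub>R\<^esub> f (n - k)"
      unfolding char_coeff_def Q.char_poly_root[OF n] f_coeff .
  qed
  then obtain p q where "monic_of_degree R (card J) p" "q \<in> carrier (UP R)" "f = p \<otimes>\<^bsub>UP R\<^esub> q" by blast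
  then have "card J = 0 \<or> n \<le> card J"
    by (rule P.irreducible_monic_factor[OF assms(5) monic])
  moreover have "i \<in> J"
    using subgroup.one_closed[OF sub] unfolding J_def sym_group_one by (auto intro!: image_eqI[of _ _ id])
  ultimately have "n \<le> card J" using finJ by auto
  then have "J = {1..n}" using J card_mono[OF _ J] by (intro card_subset_eq) auto
  then have "j \<in> J" using j by simp
  then show "\<exists>\<sigma>\<in>G. \<sigma> i = j" unfolding J_def by blast
qed

end
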